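(* Let $T>0$, let $\varepsilon$ be a nonzero real number with $|\varepsilon|<1$, and let $\Omega=\{(x,t): -\pi<x<\pi,\ 0<t<T\}$. Let $\varphi,\psi\in C^2[-\pi,\pi]$ with $\varphi''',\psi'''\in L_2(-\pi,\pi)$ and $\varphi'(\pm\pi)=\psi'(\pm\pi)=0$. Consider the inverse problem of finding a pair $(u,f)$ with $u\in C^{2,1}_{x,t}(\Omega)$, $f\in C[-\pi,\pi]$, such that $$u_t(x,t)-u_{xx}(x,t)+\varepsilon u_{xx}(-x,t)=f(x),\quad (x,t)\in\Omega,$$ $$u(x,0)=\varphi(x),\quad u(x,T)=\psi(x),\quad x\in[-\pi,\pi],$$ $$u_x(-\pi,t)=0,\quad u_x(\pi,t)=0,\quad t\in[0,T].$$ Then a unique solution of this problem exists, and it is given by $$u(x,t)=\varphi(x)+\frac tT(\psi_0-\varphi_0)+\sum_{k=1}^\infty\frac{\left(1-e^{-(1-\varepsilon)k^2t}\right)\left(\psi^{(3)}_{2k}-\varphi^{(3)}_{2k}\right)}{\left(1-e^{-(1-\varepsilon)k^2T}\right)k^3}\cos kx-\sum_{k=0}^\infty\frac{\left(1-e^{-(1+\varepsilon)(k+\frac12)^2t}\right)\left(\psi^{(3)}_{1k}-\varphi^{(3)}_{1k}\right)}{\left(1-e^{-(1+\varepsilon)(k+\frac12)^2T}\right)(k+\frac12)^3}\sin\left(k+\tfrac12\right)x,$$ $$f(x)=-\varphi''(x)+\varepsilon\varphi''(-x)+\frac{\psi_0-\varphi_0}{T}-\sum_{k=1}^\infty\frac{(1-\varepsilon)\left(\varphi^{(3)}_{2k}-\psi^{(3)}_{2k}\right)}{k\left(1-e^{-(1-\varepsilon)k^2T}\right)}\cos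 kx+\sum_{k=0}^\infty\frac{(1+\varepsilon)\left(\varphi^{(3)}_{1k}-\psi^{(3)}_{1k}\right)}{(k+\frac12)\left(1-e^{-(1+\varepsilon)(k+\frac12)^2T}\right)}\sin\left(k+\tfrac12\right)x,$$ where $$\varphi_0=\frac1{2\pi}\int_{-\pi}^\pi\varphi(x)\,dx,\quad \psi_0=\frac1{2\pi}\int_{-\pi}^\pi\psi(x)\,dx,$$ $$\varphi^{(3)}_{1k}=\frac1\pi\int_{-\pi}^\pi\varphi'''(x)\cos\left(k+\tfrac12\right)x\,dx,\quad \varphi^{(3)}_{2k}=\frac1\pi\int_{-\pi}^\pi\varphi'''(x)\sin kx\,dx,$$ $$\psi^{(3)}_{1k}=\frac1\pi\int_{-\pi}^\pi\psi'''(x)\cos\left(k+\tfrac12\right)x\,dx,\quad \psi^{(3)}_{2k}=\frac1\pi\int_{-\pi}^\pi\psi'''(x)\sin kx\,dx.$$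
   Context: $C^{2,1}_{x,t}(\Omega)$ denotes functions on $\Omega$ that are twice continuously differentiable in $x$ and once continuously differentiable in $t$. A pair $(u,f)$ with $u\in C^{2,1}_{x,t}(\Omega)$, $f\in C[-\pi,\pi]$ satisfying the equation and conditions is called a regular solution.
   Formalization: A solution u is also required to be continuous together with u_x on the closed rectangle [-π,π]×[0,T]; with u only in C^{2,1} of the open Ω, uniqueness fails (φ=ψ=0, u=t inside, u=0 at t=0 and t=T, f=1). *)

theory Defs
  imports "HOL-Analysis.Analysis"
begin

definition Omega :: "real \<Rightarrow> (real \<times> real) set" where
  "Omega T = {-pi<..<pi} \<times> {0<..<T}"

definition Omega_cl :: "real \<Rightarrow> (real \<times> real) set" where
  "Omega_cl T = {-pi..pi} \<times> {0..T}"

definition C2_L2_third ::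
  "(real \<Rightarrow> real) \<Rightarrow> (real \<Rightarrow> real) \<Rightarrow> (real \<Rightarrow> real) \<Rightarrow> (real \<Rightarrow> real) \<Rightarrow> bool" where
  "C2_L2_third g g1 g2 g3 \<longleftrightarrow>
     (\<forall>x\<in>{-pi..pi}. (g has_real_derivative g1 x) (at x within {-pi..pi})) \<and>
     (\<forall>x\<in>{-pi..pi}. (g1 has_real_derivative g2 x) (at x within {-pi..pi})) \<and>
     continuous_on {-pi..pi} g2 \<and>
     set_borel_measurable lborel {-pi..pi} g3 \<and>
     set_integrable lborel {-pi..pi} (\<lambda>x. (g3 x)\<^sup>2) \<and>
     (\<forall>x\<in>{-pi..pi}. g2 x = g2 (-pi) + (LBINT y=-pi..x. g3 y))"

text \<open>Regular solution: u continuous on the closed rectangle, u_x continuous on the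
  closed rectangle (needed for the Neumann conditions), u_xx and u_t continuous on the
  open rectangle Omega; f continuous on [-pi,pi]; equation and conditions hold.\<close>
definition regular_solution ::
  "real \<Rightarrow> real \<Rightarrow> (real \<Rightarrow> real) \<Rightarrow> (real \<Rightarrow> real) \<Rightarrow> (real \<Rightarrow> real \<Rightarrow> real) \<Rightarrow> (real \<Rightarrow> real) \<Rightarrow> bool" where
  "regular_solution T \<epsilon> \<phi> \<psi> u f \<longleftrightarrow>
    (\<exists>ux uxx ut :: real \<Rightarrow> real \<Rightarrow> real.
      continuous_on (Omega_cl T) (\<lambda>(x,t). u x t) \<and>
      (\<forall>(x,t)\<in>Omega_cl T. ((\<lambda>y. u y t) has_real_derivative ux x t) (at x within {-pi..pi})) \<and>
      continuous_on (Omega_cl T) (\<lambda>(x,t). ux x t) \<and>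
      (\<forall>(x,t)\<in>Omega T. ((\<lambda>y. ux y t) has_real_derivative uxx x t) (at x)) \<and>
      continuous_on (Omega T) (\<lambda>(x,t). uxx x t) \<and>
      (\<forall>(x,t)\<in>Omega T. ((\<lambda>s. u x s) has_real_derivative ut x t) (at t)) \<and>
      continuous_on (Omega T) (\<lambda>(x,t). ut x t) \<and>
      continuous_on {-pi..pi} f \<and>
      (\<forall>(x,t)\<in>Omega T. ut x t - uxx x t + \<epsilon> * uxx (-x) t = f x) \<and>
      (\<forall>x\<in>{-pi..pi}. u x 0 = \<phi> x \<and> u x T = \<psi> x) \<and>
      (\<forall>t\<in>{0..T}. ux (-pi) t = 0 \<and> ux pi t = 0))"

definition mean0 :: "(real \<Rightarrow> real) \<Rightarrow> real" where
  "mean0 g = 1 / (2*pi) * (LBINT x=-pi..pi. g x)"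

definition coef1 :: "(real \<Rightarrow> real) \<Rightarrow> nat \<Rightarrow> real" where
  "coef1 g3 k = 1 / pi * (LBINT x=-pi..pi. g3 x * cos ((real k + 1/2) * x))"

definition coef2 :: "(real \<Rightarrow> real) \<Rightarrow> nat \<Rightarrow> real" where
  "coef2 g3 k = 1 / pi * (LBINT x=-pi..pi. g3 x * sin (real k * x))"

definition u_sol ::
  "real \<Rightarrow> real \<Rightarrow> (real \<Rightarrow> real) \<Rightarrow> (real \<Rightarrow> real) \<Rightarrow> (real \<Rightarrow> real) \<Rightarrow> (real \<Rightarrow> real)
   \<Rightarrow> real \<Rightarrow> real \<Rightarrow> real" where
  "u_sol T \<epsilon> \<phi> \<psi> \<phi>3 \<psi>3 x t =
     \<phi> x + t / T * (mean0 \<psi> - mean0 \<phi>)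
     + (\<Sum>j. let k = real (Suc j) in
          (1 - exp (-(1-\<epsilon>) * k\<^sup>2 * t)) * (coef2 \<psi>3 (Suc j) - coef2 \<phi>3 (Suc j))
          / ((1 - exp (-(1-\<epsilon>) * k\<^sup>2 * T)) * k ^ 3) * cos (k * x))
     - (\<Sum>j. let k = real j + 1/2 in
          (1 - exp (-(1+\<epsilon>) * k\<^sup>2 * t)) * (coef1 \<psi>3 j - coef1 \<phi>3 j)
          / ((1 - exp (-(1+\<epsilon>) * k\<^sup>2 * T)) * k ^ 3) * sin (k * x))"

definition f_sol ::
  "real \<Rightarrow> real \<Rightarrow> (real \<Rightarrow> real) \<Rightarrow> (real \<Rightarrow> real) \<Rightarrow> (real \<Rightarrow> real) \<Rightarrow> (real \<Rightarrow> real)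
   \<Rightarrow> (real \<Rightarrow> real) \<Rightarrow> real \<Rightarrow> real" where
  "f_sol T \<epsilon> \<phi> \<psi> \<phi>2 \<phi>3 \<psi>3 x =
     - \<phi>2 x + \<epsilon> * \<phi>2 (-x) + (mean0 \<psi> - mean0 \<phi>) / T
     - (\<Sum>j. let k = real (Suc j) in
          (1-\<epsilon>) * (coef2 \<phi>3 (Suc j) - coef2 \<psi>3 (Suc j))
          / (k * (1 - exp (-(1-\<epsilon>) * k\<^sup>2 * T))) * cos (k * x))
     + (\<Sum>j. let k = real j + 1/2 in
          (1+\<epsilon>) * (coef1 \<phi>3 j - coef1 \<psi>3 j)
          / (k * (1 - exp (-(1+\<epsilon>) * k\<^sup>2 * T))) * sin (k * x))"

end

theory Submission
  imports Defs
begin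

text \<open>
  The even modes \<open>cos (k x)\<close> and the odd modes \<open>sin ((k + 1/2) x)\<close> satisfy the Neumann conditions
  and diagonalise the spatial operator \<open>- u_xx + \<epsilon> u_xx(-x)\<close>, with eigenvalues \<open>(1 - \<epsilon>) k\<^sup>2\<close>
  and \<open>(1 + \<epsilon>) (k + 1/2)\<^sup>2\<close>. Both families have the form \<open>cos ((j + d) x + \<theta>)\<close>, with
  \<open>(d, \<theta>) = (1, 0)\<close> or \<open>(1/2, - pi/2)\<close>, and are treated simultaneously. On each mode the problem is
  a scalar linear ODE with unknown constant right-hand side and prescribed values at both ends, which
  is uniquely solvable.

  Existence: integrating by parts three times turns the coefficients of \<open>\<phi>, \<psi>\<close> into those of their
  third derivatives divided by \<open>(j + d)^3\<close>; by Bessel's inequality the twice differentiated series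
  still converges absolutely and uniformly.

  Uniqueness and the final condition both rest on completeness of the modes: the even part of a
  continuous function is a continuous function of \<open>cos x\<close>, so Weierstrass approximation applies, and
  multiplying the odd part by \<open>sin (x/2)\<close> reduces it to the even case.
\<close>

subsection \<open>Completeness of the modes\<close>

text \<open>For a mode with eigenvalue \<open>r\<close>, the equation \<open>y' + r y = F\<close>
  with constant \<open>F\<close> and \<open>y(0) = p\<close> has the solution
  \<open>y(t) = p + (F/r - p) (1 - exp (- r t))\<close>, and the value \<open>q\<close> at time
  \<open>T\<close> forces \<open>F/r - p = (q - p) / (1 - exp (- r T))\<close>. This is the origin
  of the quotients in the formulas: \<phi> stays unexpanded, only \<psi> - \<phi> is developed in
  modes, and \<open>r (F/r - p)\<close> are the coefficients of the source beyond
  \<open>- \<phi>''(x) + \<epsilon> \<phi>''(-x)\<close>. The constant mode has \<open>r = 0\<close>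
  and gives the term linear in \<open>t\<close>. The bound on \<epsilon> makes both families of
  rates positive, which keeps the denominators away from 0 and the exponentials bounded for
  \<open>t \<ge> 0\<close>. Two obstacles shape the rest. The third derivatives are only square
  integrable and the second ones are their indefinite Lebesgue integrals, so the last integration by
  parts goes through Fubini. And an arbitrary regular solution has \<open>u_xx\<close> and
  \<open>u_t\<close> only in the open rectangle, so its moments over the full interval cannot be
  differentiated directly.\<close>

lemma even_orthogonal_cos_eq_0:
  fixes h :: "real \<Rightarrow> real"
  assumes cont: "continuous_on {-pi..pi} h"
    and even: "\<And>x. x \<in> {-pi..pi} \<Longrightarrow> h (-x) = h x"
    and orth: "\<And>k::nat. integral {-pi..pi} (\<lambda>x. h x * cos (real k * x)) = 0"
    and x: "x \<in> {-pi..pi}"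
  shows "h x = 0"
proof -
  \<comment> \<open>The factor \<open>cos (real k * x)\<close> makes the induction on
    \<open>n\<close> close: one \<open>cos x\<close> is absorbed by the product formula, which moves
    \<open>k\<close> to \<open>k + 1\<close> and \<open>k - 1\<close>. At \<open>k = 0\<close> the
    factor \<open>cos x\<close> is itself the mode of index 1.\<close>
  have power: "integral {-pi..pi} (\<lambda>x. h x * cos (real k * x) * cos x ^ n) = 0" for n k
  proof (induction n arbitrary: k)
    case 0
    then show ?case using orth by simp
  next
    case (Suc n)
    show ?case
    proof (cases k)
      case 0
      then show ?thesis using Suc.IH[of 1] by (simp add: mult_ac)
    next
      case [simp]: (Suc m)
      have "h x * cos (real k * x) * cos x ^ Suc n =
         1/2 * (h x * cos (real (Suc k) * x) * cos x ^ n + h x * cos (real m * x) * cos x ^ n)" for x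
      proof -
        have "cos (real k * x) * cos x = (cos (real (Suc k) * x) + cos (real m * x)) / 2"
          by (simp add: cos_times_cos algebra_simps)
        then have "h x * cos x ^ n * (cos (real k * x) * cos x) =
            h x * cos x ^ n * ((cos (real (Suc k) * x) + cos (real m * x)) / 2)" by simp
        then show ?thesis by (simp add: field_simps)
      qed
      then have "integral {-pi..pi} (\<lambda>x. h x * cos (real k * x) * cos x ^ Suc n) =
        integral {-pi..pi} (\<lambda>x. 1/2 * (h x * cos (real (Suc k) * x) * cos x ^ n
           + h x * cos (real m * x) * cos x ^ n))" by presburger
      also have "\<dots> = 1/2 * (integral {-pi..pi} (\<lambda>x. h x * cos (real (Suc k) * x) * cos x ^ n)
           + integral {-pi..pi} (\<lambda>x. h x * cos (real m * x) * cos x ^ n))"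
        by (subst integral_mult_right, subst integral_add)
           (auto intro!: integrable_continuous_real continuous_intros cont)
      finally show ?thesis unfolding Suc.IH by simp
    qed
  qed
  \<comment> \<open>\<open>arccos\<close> inverts \<open>cos\<close> on [0, pi]; evenness of
    \<open>h\<close> then gives \<open>h x = f (cos x)\<close> on the negative half as well.\<close>
  define f where "f = (\<lambda>y. h (arccos y))"
  have f_cont: "continuous_on {-1..1} f"
    unfolding f_def
    by (rule continuous_on_compose2[OF cont])
       (use arccos_lbound arccos_ubound pi_gt_zero in \<open>force intro!: continuous_intros\<close>)+
  have f_cos: "f (cos x) = h x" if "x \<in> {-pi..pi}" for x
  proof (cases "x \<ge> 0")
    case True
    then show ?thesis using that by (simp add: f_def arccos_cos)
  next
    case False
    then show ?thesis using that even[of x] arccos_cos[of "-x"] by (simp add: f_def)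
  qed
  define I where "I = integral {-pi..pi} (\<lambda>x. h x * h x)"
  \<comment> \<open>By \<open>power\<close>, \<open>h\<close> is orthogonal to every polynomial in
    \<open>cos x\<close>. Subtracting \<open>h x * p (cos x)\<close> from the square therefore keeps
    the integral and brings the integrand below \<open>e * \<bar>h x\<bar>\<close>.\<close>
  have le: "I \<le> e * integral {-pi..pi} (\<lambda>x. \<bar>h x\<bar>)" if "e > 0" for e
  proof -
    obtain p where p: "real_polynomial_function p" "\<And>y. y \<in> {-1..1} \<Longrightarrow> \<bar>f y - p y\<bar> < e"
      using Stone_Weierstrass_real_polynomial_function[of "{-1..1}" f e] f_cont \<open>e > 0\<close> by auto
    then obtain a n where an: "p = (\<lambda>x. \<Sum>i\<le>n. a i * x ^ i)"
      unfolding real_polynomial_function_iff_sum by blast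
    have "integral {-pi..pi} (\<lambda>x. h x * p (cos x)) =
        (\<Sum>i\<le>n. integral {-pi..pi} (\<lambda>x. a i * (h x * cos (real 0 * x) * cos x ^ i)))"
      by (subst integral_sum[symmetric])
        (auto intro!: integrable_continuous_real continuous_intros cont integral_cong simp: an sum_distrib_left mult_ac)
    also have "\<dots> = 0" by (subst integral_mult_right) (use power[of 0] in auto)
    finally have 0: "integral {-pi..pi} (\<lambda>x. h x * p (cos x)) = 0" .
    have pc: "continuous_on {-pi..pi} (\<lambda>x. p (cos x))"
      unfolding an by (intro continuous_intros)
    have "I = integral {-pi..pi} (\<lambda>x. h x * h x - h x * p (cos x))"
      unfolding I_def using 0
      by (subst integral_diff) (auto intro!: integrable_continuous_real continuous_intros cont pc)
    also have "\<dots> \<le> integral {-pi..pi} (\<lambda>x. e * \<bar>h x\<bar>)"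
    proof (rule integral_le)
      fix x assume x: "x \<in> {-pi..pi}"
      have "\<bar>h x - p (cos x)\<bar> \<le> e"
        using p(2)[of "cos x"] f_cos[OF x] by auto
      then have "\<bar>h x\<bar> * \<bar>h x - p (cos x)\<bar> \<le> \<bar>h x\<bar> * e" by (rule mult_left_mono) auto
      then have "\<bar>h x * (h x - p (cos x))\<bar> \<le> \<bar>h x\<bar> * e" by (simp add: abs_mult)
      then show "h x * h x - h x * p (cos x) \<le> e * \<bar>h x\<bar>" by (simp add: algebra_simps)
    qed (auto intro!: integrable_continuous_real continuous_intros cont pc)
    finally show ?thesis by simp
  qed
  have "I \<le> 0"
  proof (rule field_le_epsilon)
    fix e :: real assume "e > 0"
    define A where "A = integral {-pi..pi} (\<lambda>x. \<bar>h x\<bar>)"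
    have "A \<ge> 0" unfolding A_def
      by (intro integral_nonneg) (auto intro!: integrable_continuous_real continuous_intros cont)
    have "I \<le> e / (A + 1) * A" using le[of "e / (A+1)"] \<open>e > 0\<close> \<open>A \<ge> 0\<close> by (simp add: A_def)
    also have "\<dots> \<le> e" using \<open>e > 0\<close> \<open>A \<ge> 0\<close> by (simp add: field_simps)
    finally show "I \<le> 0 + e" by simp
  qed
  moreover have "I \<ge> 0" unfolding I_def
    by (intro integral_nonneg) (auto intro!: integrable_continuous_real continuous_intros cont)
  ultimately have "I = 0" by simp
  then have "\<forall>x\<in>{-pi..pi}. h x * h x = 0" unfolding I_def
    by (subst (asm) integral_eq_0_iff) (auto intro!: continuous_intros cont)
  then show ?thesis using x by auto
qed

text \<open>The cosine moments kill the even part, so \<open>h\<close> is odd and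
  \<open>h x * sin (x/2)\<close> is even. Its cosine moments vanish too, since
  \<open>sin (x/2) * cos (k x)\<close> is half the difference of the sine modes at
  \<open>k + 1/2\<close> and \<open>k - 1/2\<close>, and for \<open>k = 0\<close> is such a mode
  itself. On [-pi, pi] the factor \<open>sin (x/2)\<close> vanishes only at 0, where oddness gives
  \<open>h 0 = 0\<close>.\<close>

lemma orthogonal_cos_sin_half_eq_0:
  fixes h :: "real \<Rightarrow> real"
  assumes cont: "continuous_on {-pi..pi} h"
    and c: "\<And>k::nat. integral {-pi..pi} (\<lambda>x. h x * cos (real k * x)) = 0"
    and s: "\<And>k::nat. integral {-pi..pi} (\<lambda>x. h x * sin ((real k + 1/2) * x)) = 0"
    and x: "x \<in> {-pi..pi}"
  shows "h x = 0"
proof -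
  have cont': "continuous_on {-pi..pi} (\<lambda>x. h (-x))"
    by (rule continuous_on_compose2[OF cont]) (auto intro!: continuous_intros)
  have refl: "integral {-pi..pi} (\<lambda>x. g (-x)) = integral {-pi..pi} g" for g :: "real \<Rightarrow> real"
    using Henstock_Kurzweil_Integration.integral_reflect_real[of pi "-pi" g] by simp
  have odd: "h x + h (-x) = 0" if "x \<in> {-pi..pi}" for x
  proof (rule even_orthogonal_cos_eq_0[OF _ _ _ that])
    fix k :: nat
    have "integral {-pi..pi} (\<lambda>x. (h x + h (- x)) * cos (real k * x)) =
        integral {-pi..pi} (\<lambda>x. h x * cos (real k * x)) +
        integral {-pi..pi} (\<lambda>x. h (-x) * cos (real k * x))"
      unfolding distrib_right
      by (rule integral_add) (auto intro!: integrable_continuous_real continuous_intros cont cont')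
    then show "integral {-pi..pi} (\<lambda>x. (h x + h (- x)) * cos (real k * x)) = 0"
      using refl[of "\<lambda>x. h x * cos (real k * x)"] c by simp
  qed (auto intro!: continuous_intros cont cont')
  have s': "integral {-pi..pi} (\<lambda>x. h x * sin (x/2) * cos (real k * x)) = 0" for k
  proof (cases k)
    case 0
    then show ?thesis using s[of 0] by simp
  next
    case [simp]: (Suc m)
    have "h x * sin (x/2) * cos (real k * x) =
        1/2 * (h x * sin ((real k + 1/2) * x) - h x * sin ((real m + 1/2) * x))" for x
    proof -
      have "sin (x/2) * cos (real k * x) = (sin ((real k + 1/2) * x) - sin ((real m + 1/2) * x)) / 2"
      proof -
        have "sin (x/2) * cos (real k * x) = (sin (x/2 + real k * x) - sin (real k * x - x/2)) / 2"
          by (simp add: sin_diff sin_add mult.commute)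
        moreover have "x/2 + real k * x = (real k + 1/2) * x" "real k * x - x/2 = (real m + 1/2) * x"
          by (simp_all add: field_simps)
        ultimately show ?thesis by simp
      qed
      then show ?thesis
        unfolding mult.assoc[of "h x" "sin (x/2)"] by (simp only:) (simp add: right_diff_distrib)
    qed
    then have "integral {-pi..pi} (\<lambda>x. h x * sin (x/2) * cos (real k * x)) =
      integral {-pi..pi} (\<lambda>x. 1/2 * (h x * sin ((real k + 1/2) * x) - h x * sin ((real m + 1/2) * x)))"
      by presburger
    also have "\<dots> = 1/2 * (integral {-pi..pi} (\<lambda>x. h x * sin ((real k + 1/2) * x))
         - integral {-pi..pi} (\<lambda>x. h x * sin ((real m + 1/2) * x)))"
      by (subst integral_mult_right, subst integral_diff)
         (auto intro!: integrable_continuous_real continuous_intros cont)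
    finally show ?thesis unfolding s by simp
  qed
  have 0: "h x * sin (x/2) = 0" if "x \<in> {-pi..pi}" for x
  proof (rule even_orthogonal_cos_eq_0[OF _ _ s' that])
    fix x assume "x \<in> {-pi..pi}"
    then have "h (-x) = - h x" using odd[of x] by linarith
    then show "h (-x) * sin (-x/2) = h x * sin (x/2)" by simp
  qed (auto intro!: continuous_intros cont)
  show ?thesis
  proof (cases "x = 0")
    case True
    then show ?thesis using odd[of 0] by simp
  next
    case False
    have "sin (x/2) \<noteq> 0"
    proof (cases "x > 0")
      case True then show ?thesis using x sin_gt_zero[of "x/2"] by auto
    next
      case False
      then have "sin (-x/2) > 0" using x \<open>x \<noteq> 0\<close> by (intro sin_gt_zero) auto
      then show ?thesis by auto
    qed
    then show ?thesis using 0[OF x] by auto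
  qed
qed

subsection \<open>Bessel's inequality and integration by parts\<close>

text \<open>Projections are removed one at a time: each removal lowers the squared norm of the
  residual by \<open>N * (c n)\<^sup>2\<close>, and that norm stays nonnegative. All members of the
  family share the squared norm \<open>N\<close>, which is \<open>pi\<close> in the
  application.\<close>

lemma bessel_inequality:
  fixes g :: "'a \<Rightarrow> real" and e :: "nat \<Rightarrow> 'a \<Rightarrow> real"
  assumes g2: "integrable M (\<lambda>x. (g x)\<^sup>2)"
    and ge: "\<And>i. integrable M (\<lambda>x. g x * e i x)"
    and ee: "\<And>i j. integrable M (\<lambda>x. e i x * e j x)"
    and orth: "\<And>i j. (\<integral>x. e i x * e j x \<partial>M) = (if i = j then N else 0)"
    and N: "N > 0"
  shows "(\<Sum>k<n. (\<integral>x. g x * e k x \<partial>M)\<^sup>2) \<le> N * (\<integral>x. (g x)\<^sup>2 \<partial>M)"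
proof -
  define c where "c k = (\<integral>x. g x * e k x \<partial>M) / N" for k
  define r where "r n x = g x - (\<Sum>k<n. c k * e k x)" for n x
  have r_Suc: "r (Suc n) x = r n x - c n * e n x" for n x
    by (simp add: r_def)
  have re: "integrable M (\<lambda>x. r n x * e m x)" for n m
    unfolding r_def left_diff_distrib sum_distrib_right mult.assoc
    by (intro Bochner_Integration.integrable_diff ge Bochner_Integration.integrable_sum
        integrable_mult_right ee)
  \<comment> \<open>For \<open>n \<le> m\<close> none of the modes removed so far meets
    \<open>e m\<close>, so the residual has the same coefficient there as \<open>g\<close>.\<close>
  have re_integral: "(\<integral>x. r n x * e m x \<partial>M) = N * c m" if "n \<le> m" for n m
  proof -
    have "(\<integral>x. r n x * e m x \<partial>M) = (\<integral>x. g x * e m x \<partial>M) - (\<Sum>k<n. c k * (\<integral>x. e k x * e m x \<partial>M))"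
      unfolding r_def left_diff_distrib sum_distrib_right mult.assoc
      by (subst Bochner_Integration.integral_diff)
         (auto intro!: ge Bochner_Integration.integrable_sum integrable_mult_right ee
           simp: Bochner_Integration.integral_sum[OF integrable_mult_right[OF ee]])
    also have "(\<Sum>k<n. c k * (\<integral>x. e k x * e m x \<partial>M)) = 0"
      using that by (intro sum.neutral) (auto simp: orth)
    finally show ?thesis using N by (simp add: c_def)
  qed
  \<comment> \<open>Integrability is part of the induction because the integral of the expanded
    square can be split only when each piece is integrable.\<close>
  have "integrable M (\<lambda>x. (r n x)\<^sup>2) \<and>
      (\<integral>x. (r n x)\<^sup>2 \<partial>M) = (\<integral>x. (g x)\<^sup>2 \<partial>M) - N * (\<Sum>k<n. (c k)\<^sup>2)" for n
  proof (induction n)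
    case 0
    then show ?case using g2 by (simp add: r_def)
  next
    case (Suc n)
    have eq: "(r (Suc n) x)\<^sup>2 = (r n x)\<^sup>2 - (2 * c n) * (r n x * e n x) + (c n)\<^sup>2 * (e n x * e n x)" for x
      unfolding r_Suc by (simp add: power2_eq_square algebra_simps)
    have i: "integrable M (\<lambda>x. (r n x)\<^sup>2 - (2 * c n) * (r n x * e n x))"
      using Suc re by (intro Bochner_Integration.integrable_diff integrable_mult_right) auto
    have "(\<integral>x. (r (Suc n) x)\<^sup>2 \<partial>M) = (\<integral>x. (r n x)\<^sup>2 \<partial>M) - (2 * c n) * (N * c n) + (c n)\<^sup>2 * N"
      unfolding eq using Suc i re[of n n] ee[of n n] re_integral[of n n] orth[of n n]
      by simp
    also have "\<dots> = (\<integral>x. (g x)\<^sup>2 \<partial>M) - N * (\<Sum>k<Suc n. (c k)\<^sup>2)"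
      using Suc by (simp add: power2_eq_square algebra_simps)
    finally show ?case unfolding eq using i ee[of n n] by auto
  qed
  moreover have "(\<integral>x. (r n x)\<^sup>2 \<partial>M) \<ge> 0" by simp
  ultimately have "N * (\<Sum>k<n. (c k)\<^sup>2) \<le> (\<integral>x. (g x)\<^sup>2 \<partial>M)" by (metis diff_ge_0_iff_ge)
  then have "N * (N * (\<Sum>k<n. (c k)\<^sup>2)) \<le> N * (\<integral>x. (g x)\<^sup>2 \<partial>M)"
    using N by (intro mult_left_mono) auto
  moreover have "N * (N * (\<Sum>k<n. (c k)\<^sup>2)) = (\<Sum>k<n. (\<integral>x. g x * e k x \<partial>M)\<^sup>2)"
    using N by (simp add: sum_distrib_left c_def power2_eq_square)
  ultimately show ?thesis by simp
qed

lemma integral_cos_int_mult: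
  fixes k :: int
  assumes "k \<noteq> 0"
  shows "integral {-pi..pi} (\<lambda>x. cos (of_int k * x + \<beta>)) = 0"
proof -
  have "((\<lambda>x. cos (of_int k * x + \<beta>)) has_integral
      (sin (of_int k * pi + \<beta>) / of_int k - sin (of_int k * (-pi) + \<beta>) / of_int k)) {-pi..pi}"
    using assms by (intro fundamental_theorem_of_calculus)
      (auto simp flip: has_real_derivative_iff_has_vector_derivative intro!: derivative_eq_intros)
  moreover have "sin (of_int k * pi + \<beta>) = sin (of_int k * (-pi) + \<beta>)"
    by (simp add: sin_add sin_diff mult.commute[of _ pi])
  ultimately show ?thesis by (simp add: integral_unique)
qed

text \<open>The product formulas leave the frequencies \<open>i - j\<close> and
  \<open>i + j + 2 * d\<close>. As \<open>2 * d\<close> is a positive integer, the second is a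
  nonzero integer and integrates to 0 over the full period whatever the phase; this covers the
  half-integer family too. The sine version serves the third derivatives, since three integrations
  by parts turn cosines into sines.\<close>

lemma
  fixes d \<theta> :: real and m i j :: nat
  assumes d: "d > 0" "2 * d = real m"
  shows integral_cos_mult_cos: "integral {-pi..pi} (\<lambda>x. cos ((real i + d) * x + \<theta>) * cos ((real j + d) * x + \<theta>))
      = (if i = j then pi else 0)" (is ?A)
    and integral_sin_mult_sin: "integral {-pi..pi} (\<lambda>x. sin ((real i + d) * x + \<theta>) * sin ((real j + d) * x + \<theta>))
      = (if i = j then pi else 0)" (is ?B)
proof -
  have m: "m > 0" using d by (cases m) auto
  let ?f = "\<lambda>x. cos (of_int (int i - int j) * x + 0)"
  let ?g = "\<lambda>x. cos (of_int (int i + int j + int m) * x + 2 * \<theta>)"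
  have 1: "integral {-pi..pi} ?f = (if i = j then 2 * pi else 0)"
  proof (cases "i = j")
    case False
    then show ?thesis by (subst integral_cos_int_mult) auto
  qed auto
  have 2: "integral {-pi..pi} ?g = 0"
    using m by (intro integral_cos_int_mult) auto
  have int: "?f integrable_on {-pi..pi}" "?g integrable_on {-pi..pi}"
    by (intro integrable_continuous_real continuous_intros)+
  have arg: "of_int (int i - int j) * x + 0 = ((real i + d) * x + \<theta>) - ((real j + d) * x + \<theta>)"
    "of_int (int i + int j + int m) * x + 2 * \<theta> = ((real i + d) * x + \<theta>) + ((real j + d) * x + \<theta>)" for x
    using d(2) by (simp_all add: algebra_simps flip: d(2))
  have "(\<lambda>x. cos ((real i + d) * x + \<theta>) * cos ((real j + d) * x + \<theta>)) = (\<lambda>x. 1/2 * (?f x + ?g x))"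
    unfolding arg by (auto simp: cos_times_cos)
  then have "integral {-pi..pi} (\<lambda>x. cos ((real i + d) * x + \<theta>) * cos ((real j + d) * x + \<theta>))
     = 1/2 * (integral {-pi..pi} ?f + integral {-pi..pi} ?g)"
    by (simp only: integral_mult_right Henstock_Kurzweil_Integration.integral_add[OF int])
  then show ?A using 1 2 by auto
  have "(\<lambda>x. sin ((real i + d) * x + \<theta>) * sin ((real j + d) * x + \<theta>)) = (\<lambda>x. 1/2 * (?f x - ?g x))"
    unfolding arg by (auto simp: sin_times_sin)
  then have "integral {-pi..pi} (\<lambda>x. sin ((real i + d) * x + \<theta>) * sin ((real j + d) * x + \<theta>))
     = 1/2 * (integral {-pi..pi} ?f - integral {-pi..pi} ?g)"
    by (simp only: integral_mult_right Henstock_Kurzweil_Integration.integral_diff[OF int])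
  then show ?B using 1 2 by auto
qed

section \<open>From square integrability to summable sine coefficients\<close>

lemma set_integrable_mult_continuous:
  fixes g h :: "real \<Rightarrow> real"
  assumes g: "set_integrable lborel {a..b} g" and h: "continuous_on {a..b} h"
  shows "set_integrable lborel {a..b} (\<lambda>x. g x * h x)"
proof -
  obtain B where B: "\<And>x. x \<in> {a..b} \<Longrightarrow> \<bar>h x\<bar> \<le> B"
    using compact_imp_bounded[OF compact_continuous_image[OF h compact_Icc]]
    by (force simp: bounded_iff)
  have "set_integrable lborel {a..b} (\<lambda>x. B * g x)" using g by (intro set_integrable_mult_right) auto
  then show ?thesis
  proof (rule set_integrable_bound)
    have "set_borel_measurable lborel {a..b} h"
      using borel_integrable_atLeastAtMost'[OF h] by (auto simp: set_integrable_def set_borel_measurable_def)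
    moreover have "set_borel_measurable lborel {a..b} g"
      using g by (auto simp: set_integrable_def set_borel_measurable_def)
    ultimately have "(\<lambda>x. (indicator {a..b} x *\<^sub>R g x) * (indicator {a..b} x *\<^sub>R h x)) \<in> borel_measurable lborel"
      unfolding set_borel_measurable_def by (rule borel_measurable_times[rotated])
    moreover have "(\<lambda>x. (indicator {a..b} x *\<^sub>R g x) * (indicator {a..b} x *\<^sub>R h x)) =
       (\<lambda>x. indicator {a..b} x *\<^sub>R (g x * h x))" by (auto simp: indicator_def)
    ultimately show "set_borel_measurable lborel {a..b} (\<lambda>x. g x * h x)"
      unfolding set_borel_measurable_def by simp
    have "\<bar>g x\<bar> * \<bar>h x\<bar> \<le> \<bar>B\<bar> * \<bar>g x\<bar>" if "x \<in> {a..b}" for x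
      using mult_left_mono[of "\<bar>h x\<bar>" "\<bar>B\<bar>" "\<bar>g x\<bar>"] B[OF that] by (simp add: mult.commute)
    then show "AE x in lborel. x \<in> {a..b} \<longrightarrow> norm (g x * h x) \<le> norm (B * g x)"
      by (intro AE_I2) (auto simp: abs_mult)
  qed
qed

lemma set_integrable_of_square:
  fixes g :: "real \<Rightarrow> real"
  assumes "set_borel_measurable lborel {a..b} g" "set_integrable lborel {a..b} (\<lambda>x. (g x)\<^sup>2)"
  shows "set_integrable lborel {a..b} g"
proof -
  have "set_integrable lborel {a..b} (\<lambda>x. 1 + (g x)\<^sup>2)"
    by (rule set_integral_add(1)[OF borel_integrable_atLeastAtMost' assms(2)]) auto
  then show ?thesis
  proof (rule set_integrable_bound[OF _ assms(1)])
    have "\<bar>y\<bar> \<le> 1 + y\<^sup>2" for y :: real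
      using sum_squares_bound[of "\<bar>y\<bar>" 1] by (auto simp: power2_eq_square)
    then show "AE x in lborel. x \<in> {a..b} \<longrightarrow> norm (g x) \<le> norm (1 + (g x)\<^sup>2)"
      by (intro AE_I2) (auto intro: order_trans)
  qed
qed

text \<open>The quotient is at most \<open>(D k)\<^sup>2 + inverse (real k + d) ^ 2\<close> by the
  inequality between arithmetic and geometric mean; Bessel sums the first part and comparison with
  \<open>1 / k^2\<close> the second.\<close>

lemma summable_sin_coeffs:
  fixes g :: "real \<Rightarrow> real" and d \<theta> :: real and m :: nat
  assumes g: "set_borel_measurable lborel {-pi..pi} g" "set_integrable lborel {-pi..pi} (\<lambda>x. (g x)\<^sup>2)"
    and d: "d > 0" "2 * d = real m"
  shows "summable (\<lambda>j. \<bar>LINT x:{-pi..pi}|lborel. g x * sin ((real j + d) * x + \<theta>)\<bar> / (real j + d))"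
proof -
  define D where "D j = (LINT x:{-pi..pi}|lborel. g x * sin ((real j + d) * x + \<theta>))" for j
  \<comment> \<open>Cutting off with the indicator turns integrals over [-pi, pi] into integrals
    over \<open>lborel\<close>, the form in which Bessel's inequality applies.\<close>
  let ?i = "indicator {-pi..pi} :: real \<Rightarrow> real"
  let ?g = "\<lambda>x. ?i x * g x" and ?e = "\<lambda>j x. ?i x * sin ((real j + d) * x + \<theta>)"
  have D: "D j = (\<integral>x. ?g x * ?e j x \<partial>lborel)" for j
    unfolding D_def set_lebesgue_integral_def
    by (intro Bochner_Integration.integral_cong) (auto simp: indicator_def)
  have ee_eq: "(\<lambda>x. ?e i x * ?e j x) =
      (\<lambda>x. ?i x *\<^sub>R (sin ((real i + d) * x + \<theta>) * sin ((real j + d) * x + \<theta>)))" for i j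
    by (auto simp: indicator_def)
  have ee: "set_integrable lborel {-pi..pi} (\<lambda>x. sin ((real i + d) * x + \<theta>) * sin ((real j + d) * x + \<theta>))" for i j
    by (intro borel_integrable_atLeastAtMost' continuous_intros)
  have bessel: "(\<Sum>k<n. (D k)\<^sup>2) \<le> pi * (\<integral>x. (?g x)\<^sup>2 \<partial>lborel)" for n
    unfolding D
  proof (rule bessel_inequality[where M = lborel and N = pi and g = ?g and e = ?e])
    have "(\<lambda>x. (?g x)\<^sup>2) = (\<lambda>x. ?i x *\<^sub>R (g x)\<^sup>2)" by (auto simp: indicator_def)
    then show "integrable lborel (\<lambda>x. (?g x)\<^sup>2)" using g(2) by (simp add: set_integrable_def)
    have "set_integrable lborel {-pi..pi} (\<lambda>x. g x * sin ((real i + d) * x + \<theta>))" for i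
      by (rule set_integrable_mult_continuous[OF set_integrable_of_square[OF g]])
         (intro continuous_intros)
    moreover have "(\<lambda>x. ?g x * ?e i x) = (\<lambda>x. ?i x *\<^sub>R (g x * sin ((real i + d) * x + \<theta>)))" for i
      by (auto simp: indicator_def)
    ultimately show "integrable lborel (\<lambda>x. ?g x * ?e i x)" for i
      by (simp add: set_integrable_def)
    show "integrable lborel (\<lambda>x. ?e i x * ?e j x)" for i j
      using ee unfolding ee_eq set_integrable_def .
    show "(\<integral>x. ?e i x * ?e j x \<partial>lborel) = (if i = j then pi else 0)" for i j
      using set_borel_integral_eq_integral(2)[OF ee[of i j]] integral_sin_mult_sin[OF d, of i \<theta> j]
      unfolding ee_eq set_lebesgue_integral_def by simp
  qed simp
  have "summable (\<lambda>k. (D k)\<^sup>2)"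
    by (rule bounded_imp_summable[of _ "pi * (\<integral>x. (?g x)\<^sup>2 \<partial>lborel)"])
       (use bessel[of "Suc _"] in \<open>simp_all add: lessThan_Suc_atMost\<close>)
  moreover have "summable (\<lambda>k. inverse (real k + d) ^ 2)"
  proof (rule summable_comparison_test_ev)
    show "summable (\<lambda>k. inverse (real k ^ 2))"
      using inverse_power_summable[of 2] by simp
    show "\<forall>\<^sub>F k in sequentially. norm (inverse (real k + d) ^ 2) \<le> inverse (real k ^ 2)"
    proof (rule eventually_mono[OF eventually_gt_at_top[of 0]])
      fix k :: nat assume "k > 0"
      then show "norm (inverse (real k + d) ^ 2) \<le> inverse (real k ^ 2)"
        using d by (auto simp: power_inverse intro!: le_imp_inverse_le power_mono)
    qed
  qed
  ultimately have s: "summable (\<lambda>k. (D k)\<^sup>2 + inverse (real k + d) ^ 2)"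
    by (rule summable_add)
  show ?thesis
  proof (rule summable_comparison_test'[OF s, of 0])
    fix k :: nat
    have "\<bar>D k\<bar> * inverse (real k + d) \<le> (D k)\<^sup>2 + inverse (real k + d) ^ 2"
    proof -
      have "2 * (\<bar>D k\<bar> * inverse (real k + d)) \<le> (D k)\<^sup>2 + inverse (real k + d) ^ 2"
        using sum_squares_bound[of "\<bar>D k\<bar>" "inverse (real k + d)"] by simp
      moreover have "0 \<le> \<bar>D k\<bar> * inverse (real k + d)" using d by simp
      ultimately show ?thesis by linarith
    qed
    then show "norm (\<bar>LINT x:{-pi..pi}|lborel. g x * sin ((real k + d) * x + \<theta>)\<bar> / (real k + d))
       \<le> (D k)\<^sup>2 + inverse (real k + d) ^ 2"
      using d by (simp add: D_def divide_inverse)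
  qed
qed

section \<open>Integration by parts up to the third derivative\<close>

text \<open>\<open>F\<close> is only an indefinite Lebesgue integral, so there is no pointwise
  product rule to integrate. Instead \<open>F x - F a\<close> is written as the integral of
  \<open>g\<close> over \<open>y \<le> x\<close>, and the order of integration over the triangle is
  exchanged.\<close>

lemma integration_by_parts_indefinite_integral:
  fixes F g h h' :: "real \<Rightarrow> real"
  assumes ab: "a \<le> b" and g: "set_integrable lborel {a..b} g"
    and F: "\<And>x. x \<in> {a..b} \<Longrightarrow> F x = F a + (LBINT y=a..x. g y)"
    and h: "\<And>x. x \<in> {a..b} \<Longrightarrow> (h has_real_derivative h' x) (at x within {a..b})"
    and h': "continuous_on {a..b} h'"
  shows "integral {a..b} (\<lambda>x. F x * h' x) = F b * h b - F a * h a - (LINT y:{a..b}|lborel. g y * h y)"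
proof -
  let ?i = "indicator {a..b} :: real \<Rightarrow> real"
  define f1 where "f1 = (\<lambda>x. ?i x * h' x)"
  define f2 where "f2 = (\<lambda>x. ?i x * g x)"
  have h_cont: "continuous_on {a..b} h" using h by (rule DERIV_continuous_on)
  have f1: "integrable lborel f1"
    using borel_integrable_atLeastAtMost'[OF h'] by (simp add: set_integrable_def f1_def)
  have f2: "integrable lborel f2" using g by (simp add: set_integrable_def f2_def)
  have [measurable]: "f1 \<in> borel_measurable borel" "f2 \<in> borel_measurable borel"
    using f1 f2 by auto
  have prod: "integrable (lborel \<Otimes>\<^sub>M lborel) (\<lambda>(x, y). f1 x * f2 y)"
    by (rule lborel_pair.Fubini_integrable) (use f1 f2 in \<open>auto simp: abs_mult\<close>)
  \<comment> \<open>The integrand on the triangle \<open>y \<le> x\<close>: integrating out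
    \<open>y\<close> gives \<open>(F x - F a) * h' x\<close>, integrating out \<open>x\<close> gives
    \<open>g y * (h b - h y)\<close>. It is dominated by the integrable product
    \<open>f1 x * f2 y\<close>.\<close>
  define f where "f x y = f1 x * f2 y * (if y \<le> x then 1 else 0)" for x y
  have int: "integrable (lborel \<Otimes>\<^sub>M lborel) (case_prod f)"
  proof (rule Bochner_Integration.integrable_bound[OF prod])
    show "case_prod f \<in> borel_measurable (lborel \<Otimes>\<^sub>M lborel)"
      unfolding f_def by measurable
  qed (auto simp: f_def)
  have inner1: "(\<integral>y. f x y \<partial>lborel) = ?i x * ((F x - F a) * h' x)" for x
  proof (cases "x \<in> {a..b}")
    case True
    have "(\<integral>y. f x y \<partial>lborel) = h' x * (\<integral>y. indicator {a..x} y * g y \<partial>lborel)"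
      unfolding integral_mult_right_zero[symmetric] f_def f1_def f2_def
      by (intro Bochner_Integration.integral_cong) (use True in \<open>auto simp: indicator_def\<close>)
    also have "(\<integral>y. indicator {a..x} y * g y \<partial>lborel) = F x - F a"
      using F[OF True] True interval_integral_Icc[of a x g] by (simp add: set_lebesgue_integral_def)
    finally show ?thesis using True by simp
  qed (simp add: f_def f1_def)
  have inner2: "(\<integral>x. f x y \<partial>lborel) = ?i y * (g y * (h b - h y))" for y
  proof (cases "y \<in> {a..b}")
    case True
    have "(\<integral>x. f x y \<partial>lborel) = g y * (\<integral>x. indicator {y..b} x * h' x \<partial>lborel)"
      unfolding integral_mult_right_zero[symmetric] f_def f1_def f2_def
      by (intro Bochner_Integration.integral_cong) (use True in \<open>auto simp: indicator_def\<close>)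
    also have "(\<integral>x. indicator {y..b} x * h' x \<partial>lborel) = h b - h y"
    proof -
      have c: "continuous_on {y..b} h'" using True by (intro continuous_on_subset[OF h']) auto
      have "(h' has_integral (h b - h y)) {y..b}"
        using True by (intro fundamental_theorem_of_calculus)
          (auto simp flip: has_real_derivative_iff_has_vector_derivative intro: DERIV_subset[OF h])
      then show ?thesis
        using set_borel_integral_eq_integral(2)[OF borel_integrable_atLeastAtMost'[OF c]]
        by (simp add: set_lebesgue_integral_def integral_unique)
    qed
    finally show ?thesis using True by simp
  qed (simp add: f_def f2_def)
  have F_cont: "continuous_on {a..b} F"
  proof -
    have "continuous_on {a..b} (\<lambda>x. F a + integral {a..x} g)"
      using set_borel_integral_eq_integral(1)[OF g]
      by (intro continuous_intros indefinite_integral_continuous_1)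
    moreover have "F a + integral {a..x} g = F x" if "x \<in> {a..b}" for x
      using F[OF that] that interval_integral_Icc[of a x g]
        set_borel_integral_eq_integral(2)[OF set_integrable_subset[OF g, of "{a..x}"]] by auto
    ultimately show ?thesis by (metis (no_types, lifting) continuous_on_cong)
  qed
  have "(\<integral>x. ?i x * ((F x - F a) * h' x) \<partial>lborel) = (\<integral>y. ?i y * (g y * (h b - h y)) \<partial>lborel)"
    using lborel_pair.Fubini_integral[OF int] unfolding inner1 inner2 by simp
  moreover have "(\<integral>x. ?i x * ((F x - F a) * h' x) \<partial>lborel) =
      integral {a..b} (\<lambda>x. F x * h' x) - F a * (h b - h a)"
  proof -
    have "(\<integral>x. ?i x * ((F x - F a) * h' x) \<partial>lborel) = integral {a..b} (\<lambda>x. (F x - F a) * h' x)"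
      using set_borel_integral_eq_integral(2)[OF borel_integrable_atLeastAtMost'[of a b "\<lambda>x. (F x - F a) * h' x"]]
        F_cont h' by (simp add: set_lebesgue_integral_def continuous_intros)
    also have "\<dots> = integral {a..b} (\<lambda>x. F x * h' x) - integral {a..b} (\<lambda>x. F a * h' x)"
      unfolding left_diff_distrib
      by (intro Henstock_Kurzweil_Integration.integral_diff integrable_continuous_real continuous_intros F_cont h')
    also have "integral {a..b} (\<lambda>x. F a * h' x) = F a * (h b - h a)"
    proof -
      have "(h' has_integral (h b - h a)) {a..b}"
        using ab by (intro fundamental_theorem_of_calculus)
          (auto simp flip: has_real_derivative_iff_has_vector_derivative intro: h)
      then show ?thesis by (simp add: integral_unique)
    qed
    finally show ?thesis .
  qed
  moreover have "(\<integral>y. ?i y * (g y * (h b - h y)) \<partial>lborel) =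
      h b * (F b - F a) - (LINT y:{a..b}|lborel. g y * h y)"
  proof -
    have "(\<integral>y. ?i y * (g y * (h b - h y)) \<partial>lborel) = (LINT y:{a..b}|lborel. h b * g y - g y * h y)"
      unfolding set_lebesgue_integral_def
      by (intro Bochner_Integration.integral_cong) (auto simp: algebra_simps)
    also have "\<dots> = h b * (LINT y:{a..b}|lborel. g y) - (LINT y:{a..b}|lborel. g y * h y)"
      using g by (subst set_integral_diff) (auto intro!: set_integrable_mult_continuous h_cont)
    also have "(LINT y:{a..b}|lborel. g y) = F b - F a"
      using F[of b] ab interval_integral_Icc[of a b g] by simp
    finally show ?thesis .
  qed
  ultimately show ?thesis by (simp add: algebra_simps)
qed

lemma integral_by_parts_continuous:
  fixes f f' h h' :: "real \<Rightarrow> real"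
  assumes ab: "a \<le> b"
    and f: "\<And>x. x \<in> {a..b} \<Longrightarrow> (f has_real_derivative f' x) (at x within {a..b})"
    and h: "\<And>x. x \<in> {a..b} \<Longrightarrow> (h has_real_derivative h' x) (at x within {a..b})"
    and f': "continuous_on {a..b} f'" and h': "continuous_on {a..b} h'"
  shows "integral {a..b} (\<lambda>x. f x * h' x) = f b * h b - f a * h a - integral {a..b} (\<lambda>x. f' x * h x)"
proof -
  have fc: "continuous_on {a..b} f" by (rule DERIV_continuous_on[OF f])
  have hc: "continuous_on {a..b} h" by (rule DERIV_continuous_on[OF h])
  have "((\<lambda>x. f x * h' x + f' x * h x) has_integral (f b * h b - f a * h a)) {a..b}"
    using ab by (intro fundamental_theorem_of_calculus)
      (auto simp flip: has_real_derivative_iff_has_vector_derivative intro!: derivative_eq_intros f h)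
  then have "integral {a..b} (\<lambda>x. f x * h' x + f' x * h x) = f b * h b - f a * h a"
    by (rule integral_unique)
  moreover have "integral {a..b} (\<lambda>x. f x * h' x + f' x * h x) =
      integral {a..b} (\<lambda>x. f x * h' x) + integral {a..b} (\<lambda>x. f' x * h x)"
    by (intro Henstock_Kurzweil_Integration.integral_add integrable_continuous_real continuous_intros fc hc f' h')
  ultimately show ?thesis by simp
qed

lemma C2_L2_third_set_integrable:
  assumes "C2_L2_third g g1 g2 g3"
  shows "set_integrable lborel {-pi..pi} g3"
  using assms unfolding C2_L2_third_def by - (rule set_integrable_of_square; blast)

lemma C2_L2_third_continuous:
  assumes "C2_L2_third g g1 g2 g3"
  shows "continuous_on {-pi..pi} g" "continuous_on {-pi..pi} g1" "continuous_on {-pi..pi} g2"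
  using assms unfolding C2_L2_third_def by (blast intro: DERIV_continuous_on)+

text \<open>The boundary terms of the first and third integration by parts vanish because the sine
  does at both ends, that of the second because \<open>g1\<close> does. The three signs combine to
  plus.\<close>

lemma integral_cos_eq_third_derivative:
  assumes C: "C2_L2_third g g1 g2 g3" and bc: "g1 (-pi) = 0" "g1 pi = 0"
    and L: "L \<noteq> 0" and \<theta>: "sin (L * pi + \<theta>) = 0" "sin (-L * pi + \<theta>) = 0"
  shows "integral {-pi..pi} (\<lambda>x. g x * cos (L * x + \<theta>)) =
      (LINT x:{-pi..pi}|lborel. g3 x * sin (L * x + \<theta>)) / L ^ 3"
proof -
  have g: "\<And>x. x \<in> {-pi..pi} \<Longrightarrow> (g has_real_derivative g1 x) (at x within {-pi..pi})"
    and g1: "\<And>x. x \<in> {-pi..pi} \<Longrightarrow> (g1 has_real_derivative g2 x) (at x within {-pi..pi})"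
    and g2: "\<And>x. x \<in> {-pi..pi} \<Longrightarrow> g2 x = g2 (-pi) + (LBINT y=-pi..x. g3 y)"
    using C unfolding C2_L2_third_def by blast+
  note cont = C2_L2_third_continuous[OF C]
  let ?s = "\<lambda>x. sin (L * x + \<theta>)" and ?c = "\<lambda>x. cos (L * x + \<theta>)"
  have d1: "((\<lambda>x. ?s x / L) has_real_derivative ?c x) (at x within A)" for x A
    using L by (auto intro!: derivative_eq_intros)
  have d2: "((\<lambda>x. - ?c x / L) has_real_derivative ?s x) (at x within A)" for x A
    using L by (auto intro!: derivative_eq_intros)
  have 1: "integral {-pi..pi} (\<lambda>x. g x * ?c x) = - integral {-pi..pi} (\<lambda>x. g1 x * (?s x / L))"
    by (subst integral_by_parts_continuous[OF _ g d1]) (use \<theta> in \<open>auto intro!: cont continuous_intros\<close>)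
  have 2: "integral {-pi..pi} (\<lambda>x. g1 x * ?s x) = - integral {-pi..pi} (\<lambda>x. g2 x * (- ?c x / L))"
    by (subst integral_by_parts_continuous[OF _ g1 d2]) (use bc in \<open>auto intro!: cont continuous_intros\<close>)
  have 3: "integral {-pi..pi} (\<lambda>x. g2 x * ?c x) = - (LINT x:{-pi..pi}|lborel. g3 x * (?s x / L))"
    by (subst integration_by_parts_indefinite_integral[OF _ C2_L2_third_set_integrable[OF C] g2 d1])
       (use \<theta> in \<open>auto intro!: continuous_intros\<close>)
  show ?thesis
    using 1 2 3 L by (simp add: power3_eq_cube field_simps)
qed

subsection \<open>Series of modes\<close>

lemma continuous_on_suminf_M_test:
  fixes f :: "nat \<Rightarrow> 'a::topological_space \<Rightarrow> real"
  assumes "\<And>n. continuous_on A (f n)" "\<And>n x. x \<in> A \<Longrightarrow> \<bar>f n x\<bar> \<le> M n" "summable M"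
  shows "continuous_on A (\<lambda>x. \<Sum>n. f n x)"
proof (rule uniform_limit_theorem)
  show "uniform_limit A (\<lambda>n x. \<Sum>i<n. f i x) (\<lambda>x. \<Sum>n. f n x) sequentially"
    using assms by (intro Weierstrass_m_test) auto
  show "\<forall>\<^sub>F n in sequentially. continuous_on A (\<lambda>x. \<Sum>i<n. f i x)"
    using assms by (intro always_eventually allI continuous_on_sum) auto
qed simp

lemma has_real_derivative_suminf_M_test:
  fixes f :: "nat \<Rightarrow> real \<Rightarrow> real"
  assumes "convex S" "\<And>n x. x \<in> S \<Longrightarrow> (f n has_real_derivative f' n x) (at x within S)"
    "\<And>n x. x \<in> S \<Longrightarrow> \<bar>f' n x\<bar> \<le> M n" "summable M"
    "\<And>x. x \<in> S \<Longrightarrow> summable (\<lambda>n. f n x)" and x: "x \<in> S"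
  shows "((\<lambda>x. \<Sum>n. f n x) has_real_derivative (\<Sum>n. f' n x)) (at x within S)"
proof -
  have ul: "uniform_limit S (\<lambda>n x. \<Sum>i<n. f' i x) (\<lambda>x. \<Sum>n. f' n x) sequentially"
    using assms by (intro Weierstrass_m_test) auto
  obtain g where g: "\<And>x. x \<in> S \<Longrightarrow> (\<lambda>n. f n x) sums g x"
    "\<And>x. x \<in> S \<Longrightarrow> (g has_real_derivative (\<Sum>n. f' n x)) (at x within S)"
    using has_field_derivative_series[OF assms(1,2) ul x assms(5)[OF x]] by blast
  show ?thesis
    by (rule has_field_derivative_transform_within[OF g(2)[OF x] zero_less_one x])
       (use g(1) in \<open>auto simp: sums_iff\<close>)
qed

lemma integral_suminf_M_test:
  fixes f :: "nat \<Rightarrow> real \<Rightarrow> real"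
  assumes "\<And>n. continuous_on {a..b} (f n)" "\<And>n x. x \<in> {a..b} \<Longrightarrow> \<bar>f n x\<bar> \<le> M n" "summable M"
  shows "(\<lambda>n. integral {a..b} (f n)) sums integral {a..b} (\<lambda>x. \<Sum>n. f n x)"
proof -
  have ul: "uniform_limit {a..b} (\<lambda>n x. \<Sum>i<n. f i x) (\<lambda>x. \<Sum>n. f n x) sequentially"
    using assms by (intro Weierstrass_m_test) auto
  have c: "continuous_on {a..b} (\<lambda>x. \<Sum>i<n. f i x)" for n
    using assms by (intro continuous_on_sum) auto
  obtain I J where I: "\<And>n. ((\<lambda>x. \<Sum>i<n. f i x) has_integral I n) {a..b}"
    and J: "((\<lambda>x. \<Sum>n. f n x) has_integral J) {a..b}" and IJ: "I \<longlonglongrightarrow> J"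
    using uniform_limit_integral[OF ul c] by auto
  have "I n = (\<Sum>i<n. integral {a..b} (f i))" for n
  proof -
    have "((\<lambda>x. \<Sum>i<n. f i x) has_integral (\<Sum>i<n. integral {a..b} (f i))) {a..b}"
      using assms(1) by (intro has_integral_sum integrable_integral integrable_continuous_real) auto
    then show ?thesis using I[of n] has_integral_unique by blast
  qed
  then have "I = (\<lambda>n. \<Sum>i<n. integral {a..b} (f i))" by blast
  then show ?thesis
    using IJ J by (simp add: sums_def integral_unique)
qed

text \<open>The free phase closes the class under differentiation in \<open>x\<close>: the
  coefficients are multiplied by \<open>j + d\<close> and \<open>pi/2\<close> is added to \<theta>.
  For \<open>d = 1\<close> the index \<open>j\<close> stands for the frequency \<open>j + 1\<close>;
  the constant mode is left out.\<close>

definition mode_series :: "(nat \<Rightarrow> real) \<Rightarrow> real \<Rightarrow> real \<Rightarrow> real \<Rightarrow> real" where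
  "mode_series a d \<theta> x = (\<Sum>j. a j * cos ((real j + d) * x + \<theta>))"

text \<open>The abstract parameter \<open>z\<close> covers both uses: joint continuity in
  \<open>(x, t)\<close> with coefficients depending on \<open>t\<close>, and continuity in
  \<open>x\<close> with fixed coefficients.\<close>

lemma continuous_on_mode_series:
  fixes a :: "'a::t2_space \<Rightarrow> nat \<Rightarrow> real" and M :: "nat \<Rightarrow> real"
  assumes M: "summable M" and bound: "\<And>z j. z \<in> A \<Longrightarrow> \<bar>a z j\<bar> \<le> M j"
    and cont: "\<And>j. continuous_on A (\<lambda>z. a z j)" and \<xi>: "continuous_on A \<xi>"
  shows "continuous_on A (\<lambda>z. mode_series (a z) d \<theta> (\<xi> z))"
  unfolding mode_series_def
proof (rule continuous_on_suminf_M_test[OF _ _ M])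
  show "continuous_on A (\<lambda>z. a z j * cos ((real j + d) * \<xi> z + \<theta>))" for j
    by (intro continuous_intros cont \<xi>)
  show "\<bar>a z j * cos ((real j + d) * \<xi> z + \<theta>)\<bar> \<le> M j" if "z \<in> A" for z j
    using mult_mono[OF bound[OF that] abs_cos_le_one] bound[OF that, of j] by (simp add: abs_mult)
qed

lemma mode_series_has_derivative_coeffs:
  fixes a a' :: "real \<Rightarrow> nat \<Rightarrow> real" and M :: "nat \<Rightarrow> real"
  assumes M: "summable M" and S: "convex S" "t \<in> S"
    and a: "\<And>s j. s \<in> S \<Longrightarrow> \<bar>a s j\<bar> \<le> M j" and a': "\<And>s j. s \<in> S \<Longrightarrow> \<bar>a' s j\<bar> \<le> M j"
    and D: "\<And>s j. s \<in> S \<Longrightarrow> ((\<lambda>s. a s j) has_real_derivative a' s j) (at s within S)"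
  shows "((\<lambda>s. mode_series (a s) d \<theta> x) has_real_derivative mode_series (a' t) d \<theta> x) (at t within S)"
  unfolding mode_series_def
proof (rule has_real_derivative_suminf_M_test[OF S(1) _ _ M _ S(2)])
  show "((\<lambda>s. a s n * cos ((real n + d) * x + \<theta>)) has_real_derivative
      a' s n * cos ((real n + d) * x + \<theta>)) (at s within S)" if "s \<in> S" for s n
    by (rule DERIV_cmult_right[OF D[OF that]])
  have le: "\<bar>b * cos y\<bar> \<le> m" if "\<bar>b\<bar> \<le> m" for b y m :: real
    using mult_mono[OF that abs_cos_le_one[of y]] that by (simp add: abs_mult)
  show "\<bar>a' s n * cos ((real n + d) * x + \<theta>)\<bar> \<le> M n" if "s \<in> S" for s n
    by (rule le[OF a'[OF that]])
  show "summable (\<lambda>n. a s n * cos ((real n + d) * x + \<theta>))" if "s \<in> S" for s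
    by (rule summable_comparison_test'[OF M, of 0]) (use le[OF a[OF that]] in auto)
qed

lemma mode_series_has_derivative:
  fixes a :: "nat \<Rightarrow> real"
  assumes a: "summable (\<lambda>j. \<bar>a j\<bar>)" and a1: "summable (\<lambda>j. \<bar>a j\<bar> * (real j + d))" and d: "d > 0"
  shows "(mode_series a d \<theta> has_real_derivative
    mode_series (\<lambda>j. a j * (real j + d)) d (\<theta> + pi/2) x) (at x)"
proof -
  have "((\<lambda>x. \<Sum>j. a j * cos ((real j + d) * x + \<theta>)) has_real_derivative
    (\<Sum>j. a j * (real j + d) * cos ((real j + d) * x + (\<theta> + pi/2)))) (at x within UNIV)"
  proof (rule has_real_derivative_suminf_M_test[OF _ _ _ a1])
    show "((\<lambda>x. a n * cos ((real n + d) * x + \<theta>)) has_real_derivative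
       a n * (real n + d) * cos ((real n + d) * x + (\<theta> + pi/2))) (at x within UNIV)" for n x
    proof -
      have *: "cos (y + (\<theta> + pi/2)) = - sin (y + \<theta>)" for y
        by (simp add: cos_add sin_add)
      show ?thesis unfolding * by (auto intro!: derivative_eq_intros)
    qed
    show "\<bar>a n * (real n + d) * cos ((real n + d) * x + (\<theta> + pi/2))\<bar> \<le> \<bar>a n\<bar> * (real n + d)" for n x
      using d mult_left_mono[OF abs_cos_le_one, of "\<bar>a n\<bar> * (real n + d)"] by (simp add: abs_mult)
    show "summable (\<lambda>n. a n * cos ((real n + d) * x + \<theta>))" for x
      by (rule summable_comparison_test'[OF a, of 0])
         (simp add: abs_mult mult_left_le)
  qed auto
  then show ?thesis by (simp add: mode_series_def[abs_def])
qed

lemma integral_mode_series: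
  fixes a :: "nat \<Rightarrow> real"
  assumes a: "summable (\<lambda>j. \<bar>a j\<bar>)" and h: "continuous_on {-pi..pi} h"
  shows "(\<lambda>j. a j * integral {-pi..pi} (\<lambda>x. cos ((real j + d) * x + \<theta>) * h x)) sums
     integral {-pi..pi} (\<lambda>x. mode_series a d \<theta> x * h x)"
proof -
  obtain B where B: "\<And>x. x \<in> {-pi..pi} \<Longrightarrow> \<bar>h x\<bar> \<le> B"
    using compact_imp_bounded[OF compact_continuous_image[OF h compact_Icc]]
    by (force simp: bounded_iff)
  let ?f = "\<lambda>j x. a j * (cos ((real j + d) * x + \<theta>) * h x)"
  have "(\<lambda>j. integral {-pi..pi} (?f j)) sums integral {-pi..pi} (\<lambda>x. \<Sum>j. ?f j x)"
  proof (rule integral_suminf_M_test)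
    show "summable (\<lambda>j. \<bar>a j\<bar> * B)" using a by (rule summable_mult2)
    show "\<bar>?f j x\<bar> \<le> \<bar>a j\<bar> * B" if "x \<in> {-pi..pi}" for j x
    proof -
      have "\<bar>cos ((real j + d) * x + \<theta>)\<bar> * \<bar>h x\<bar> \<le> 1 * B"
        using B[OF that] by (intro mult_mono) auto
      from mult_left_mono[OF this, of "\<bar>a j\<bar>"] show ?thesis by (simp add: abs_mult)
    qed
  qed (intro continuous_intros h)
  moreover have "(\<Sum>j. ?f j x) = mode_series a d \<theta> x * h x" for x
  proof -
    have "summable (\<lambda>j. a j * cos ((real j + d) * x + \<theta>))"
      by (rule summable_comparison_test'[OF a, of 0])
         (simp add: abs_mult mult_left_le)
    from suminf_mult2[OF this, of "h x"] show ?thesis by (simp add: mode_series_def mult_ac)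
  qed
  ultimately show ?thesis by simp
qed

lemma integral_mode_series_cos:
  fixes a :: "nat \<Rightarrow> real" and d :: real
  assumes "summable (\<lambda>j. \<bar>a j\<bar>)" "d > 0" "2 * d = real m"
  shows "integral {-pi..pi} (\<lambda>x. mode_series a d \<theta> x * cos ((real i + d) * x + \<theta>)) = pi * a i"
proof -
  have "(\<lambda>j. a j * (if j = i then pi else 0)) sums
     integral {-pi..pi} (\<lambda>x. mode_series a d \<theta> x * cos ((real i + d) * x + \<theta>))"
    using integral_mode_series[OF assms(1), of "\<lambda>x. cos ((real i + d) * x + \<theta>)" d \<theta>]
    unfolding integral_cos_mult_cos[OF assms(2,3)] by (simp add: continuous_intros)
  moreover have "(\<lambda>j. a j * (if j = i then pi else 0)) sums (a i * pi)"
    using sums_single[of i "\<lambda>j. a j * pi"] by (simp add: if_distrib cong: if_cong)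
  ultimately have "integral {-pi..pi} (\<lambda>x. mode_series a d \<theta> x * cos ((real i + d) * x + \<theta>)) = a i * pi"
    by (rule sums_unique2)
  then show ?thesis by simp
qed

lemma integral_mode_series_eq_0:
  fixes a :: "nat \<Rightarrow> real"
  assumes a: "summable (\<lambda>j. \<bar>a j\<bar>)" and h: "continuous_on {-pi..pi} h"
    and 0: "\<And>j. integral {-pi..pi} (\<lambda>x. cos ((real j + d) * x + \<theta>) * h x) = 0"
  shows "integral {-pi..pi} (\<lambda>x. mode_series a d \<theta> x * h x) = 0"
proof -
  have "(\<lambda>j. 0) sums integral {-pi..pi} (\<lambda>x. mode_series a d \<theta> x * h x)"
    using integral_mode_series[OF a h, of d \<theta>] by (simp only: 0 mult_zero_right)
  then show ?thesis by (rule sums_unique2[OF _ sums_zero])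
qed

text \<open>Two differentiations in \<open>x\<close> shift the phase twice by \<open>pi/2\<close>;
  the resulting half period is the minus sign in the second derivative.\<close>

lemma mode_series_plus_pi:
  assumes "summable (\<lambda>j. a j * cos ((real j + d) * x + \<theta>))"
  shows "mode_series a d (\<theta> + pi/2 + pi/2) x = - mode_series a d \<theta> x"
proof -
  have "a j * cos ((real j + d) * x + (\<theta> + pi/2 + pi/2)) = - (a j * cos ((real j + d) * x + \<theta>))" for j
  proof -
    have "(real j + d) * x + (\<theta> + pi/2 + pi/2) = ((real j + d) * x + \<theta>) + pi" by simp
    then show ?thesis by (simp only: cos_periodic_pi mult_minus_right)
  qed
  then show ?thesis unfolding mode_series_def by (simp only: suminf_minus[OF assms])
qed

section \<open>Time-dependent mode series\<close>

text \<open>With \<open>r = c * (real j + d)\<^sup>2\<close> this is the solution of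
  \<open>y' + r y = r * b j\<close> starting from 0; for positive \<open>r\<close> it relaxes
  towards \<open>b j\<close>.\<close>

definition relax_coef :: "real \<Rightarrow> real \<Rightarrow> (nat \<Rightarrow> real) \<Rightarrow> real \<Rightarrow> nat \<Rightarrow> real" where
  "relax_coef c d b t j = b j * (1 - exp (- c * (real j + d)\<^sup>2 * t))"

lemma abs_relax_coef_le:
  assumes "c > 0" "t \<ge> 0"
  shows "\<bar>relax_coef c d b t j\<bar> \<le> \<bar>b j\<bar>"
proof -
  have "\<bar>1 - exp (- c * (real j + d)\<^sup>2 * t)\<bar> \<le> 1" using assms by (simp add: abs_le_iff)
  from mult_left_mono[OF this, of "\<bar>b j\<bar>"] show ?thesis by (simp add: relax_coef_def abs_mult)
qed

lemma summable_mode_powers: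
  fixes b :: "nat \<Rightarrow> real"
  assumes b: "summable (\<lambda>j. \<bar>b j\<bar> * (real j + d)\<^sup>2)" and d: "d > 0"
  shows "summable (\<lambda>j. \<bar>b j\<bar>)" "summable (\<lambda>j. \<bar>b j\<bar> * (real j + d))"
proof -
  show "summable (\<lambda>j. \<bar>b j\<bar>)"
  proof (rule summable_comparison_test'[OF summable_mult[OF b, of "1 / d\<^sup>2"], of 0])
    fix j :: nat
    have "d\<^sup>2 \<le> (real j + d)\<^sup>2" using d by (intro power_mono) auto
    from mult_left_mono[OF this, of "\<bar>b j\<bar>"] show "norm \<bar>b j\<bar> \<le> 1 / d\<^sup>2 * (\<bar>b j\<bar> * (real j + d)\<^sup>2)"
      using d by (simp add: field_simps)
  qed
  show "summable (\<lambda>j. \<bar>b j\<bar> * (real j + d))"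
  proof (rule summable_comparison_test'[OF summable_mult[OF b, of "1 / d"], of 0])
    fix j :: nat
    have "d * (real j + d) \<le> (real j + d)\<^sup>2" using d unfolding power2_eq_square by (intro mult_right_mono) auto
    from mult_left_mono[OF this, of "\<bar>b j\<bar>"]
    show "norm (\<bar>b j\<bar> * (real j + d)) \<le> 1 / d * (\<bar>b j\<bar> * (real j + d)\<^sup>2)"
      using d by (simp add: field_simps abs_mult)
  qed
qed

text \<open>For \<open>t \<ge> 0\<close> the amplitudes are at most \<open>\<bar>b j\<bar>\<close>
  and the exponential at most 1, so up to the factor \<open>c\<close> the assumed majorant serves
  the second derivative in \<open>x\<close> and the derivative in \<open>t\<close>, and continuity
  reaches \<open>t = 0\<close>. In the last claim the exponentials cancel, leaving a right-hand side
  free of \<open>t\<close>: this is why the source can depend on \<open>x\<close> alone.\<close>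

lemma
  fixes b :: "nat \<Rightarrow> real" and c d \<theta> :: real
  assumes b: "summable (\<lambda>j. \<bar>b j\<bar> * (real j + d)\<^sup>2)" and d: "d > 0" and c: "c > 0"
  defines "a \<equiv> relax_coef c d b"
    and "a' \<equiv> \<lambda>t j. b j * (c * (real j + d)\<^sup>2 * exp (- c * (real j + d)\<^sup>2 * t))"
  shows relax_series_continuous:
      "continuous_on {z. 0 \<le> snd z} (\<lambda>(x,t). mode_series (a t) d \<theta> x)"
      "continuous_on {z. 0 \<le> snd z} (\<lambda>(x,t). mode_series (\<lambda>j. a t j * (real j + d)) d (\<theta> + pi/2) x)"
      "continuous_on {z. 0 \<le> snd z} (\<lambda>(x,t). mode_series (\<lambda>j. a t j * (real j + d)\<^sup>2) d \<theta> x)"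
      "continuous_on {z. 0 \<le> snd z} (\<lambda>(x,t). mode_series (a' t) d \<theta> x)"
    and relax_series_deriv_x: "\<And>x t. t \<ge> 0 \<Longrightarrow> ((\<lambda>y. mode_series (a t) d \<theta> y) has_real_derivative
      mode_series (\<lambda>j. a t j * (real j + d)) d (\<theta> + pi/2) x) (at x)"
    and relax_series_deriv_xx: "\<And>x t. t \<ge> 0 \<Longrightarrow> ((\<lambda>y. mode_series (\<lambda>j. a t j * (real j + d)) d (\<theta> + pi/2) y)
      has_real_derivative - mode_series (\<lambda>j. a t j * (real j + d)\<^sup>2) d \<theta> x) (at x)"
    and relax_series_deriv_t: "\<And>x t. t > 0 \<Longrightarrow> ((\<lambda>s. mode_series (a s) d \<theta> x) has_real_derivative
      mode_series (a' t) d \<theta> x) (at t)"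
    and relax_series_ode: "\<And>x t. t \<ge> 0 \<Longrightarrow> mode_series (a' t) d \<theta> x +
      c * mode_series (\<lambda>j. a t j * (real j + d)\<^sup>2) d \<theta> x = mode_series (\<lambda>j. c * (real j + d)\<^sup>2 * b j) d \<theta> x"
proof -
  note b0 = summable_mode_powers(1)[OF b d] and b1 = summable_mode_powers(2)[OF b d]
  have a_le: "\<bar>a t j\<bar> \<le> \<bar>b j\<bar>" if "t \<ge> 0" for t j
    unfolding a_def by (rule abs_relax_coef_le[OF c that])
  have a1_le: "\<bar>a t j * (real j + d)\<bar> \<le> \<bar>b j\<bar> * (real j + d)" if "t \<ge> 0" for t j
    using mult_right_mono[OF a_le[OF that], of "real j + d" j] d by (simp add: abs_mult)
  have a2_le: "\<bar>a t j * (real j + d)\<^sup>2\<bar> \<le> \<bar>b j\<bar> * (real j + d)\<^sup>2" if "t \<ge> 0" for t j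
    using mult_right_mono[OF a_le[OF that], of "(real j + d)\<^sup>2" j] by (simp add: abs_mult)
  have a'_le: "\<bar>a' t j\<bar> \<le> c * (\<bar>b j\<bar> * (real j + d)\<^sup>2)" if "t \<ge> 0" for t j
  proof -
    have "exp (- c * (real j + d)\<^sup>2 * t) \<le> 1" using c that by simp
    from mult_left_mono[OF this, of "c * (\<bar>b j\<bar> * (real j + d)\<^sup>2)"] show ?thesis
      using c by (simp add: a'_def abs_mult mult_ac)
  qed
  have a_cont: "continuous_on A (\<lambda>z. a (snd z) j)" "continuous_on A (\<lambda>z. a' (snd z) j)"
    for A :: "(real \<times> real) set" and j
    unfolding a_def a'_def relax_coef_def by (intro continuous_intros)+
  let ?A = "{z :: real \<times> real. 0 \<le> snd z}"
  show "continuous_on ?A (\<lambda>(x,t). mode_series (a t) d \<theta> x)"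
    unfolding split_beta
    by (rule continuous_on_mode_series[OF b0]) (auto intro!: a_le a_cont continuous_intros)
  show "continuous_on ?A (\<lambda>(x,t). mode_series (\<lambda>j. a t j * (real j + d)) d (\<theta> + pi/2) x)"
    unfolding split_beta
    by (rule continuous_on_mode_series[OF b1]) (auto intro!: a1_le a_cont continuous_intros)
  show "continuous_on ?A (\<lambda>(x,t). mode_series (\<lambda>j. a t j * (real j + d)\<^sup>2) d \<theta> x)"
    unfolding split_beta
    by (rule continuous_on_mode_series[OF b]) (auto intro!: a2_le a_cont continuous_intros)
  show "continuous_on ?A (\<lambda>(x,t). mode_series (a' t) d \<theta> x)"
    unfolding split_beta
    by (rule continuous_on_mode_series[OF summable_mult[OF b, of c]])
       (auto intro!: a'_le a_cont continuous_intros)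
  have cos_le: "\<bar>p * cos y\<bar> \<le> m" if "\<bar>p\<bar> \<le> m" for p y m :: real
    using mult_mono[OF that abs_cos_le_one[of y]] that by (simp add: abs_mult)
  have a_s: "summable (\<lambda>j. \<bar>a t j\<bar>)" "summable (\<lambda>j. \<bar>a t j\<bar> * (real j + d))"
      "summable (\<lambda>j. a t j * (real j + d)\<^sup>2 * cos ((real j + d) * x + \<theta>))"
      "summable (\<lambda>j. a' t j * cos ((real j + d) * x + \<theta>))"
      "summable (\<lambda>j. \<bar>a t j * (real j + d)\<bar>)" "summable (\<lambda>j. \<bar>a t j * (real j + d)\<bar> * (real j + d))"
    if t: "t \<ge> 0" for t x
  proof -
    show "summable (\<lambda>j. \<bar>a t j\<bar>)"
      by (rule summable_comparison_test'[OF b0, of 0]) (use a_le[OF t] in auto)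
    show "summable (\<lambda>j. \<bar>a t j\<bar> * (real j + d))"
      by (rule summable_comparison_test'[OF b1, of 0]) (use a1_le[OF t] in \<open>auto simp: abs_mult\<close>)
    show "summable (\<lambda>j. a t j * (real j + d)\<^sup>2 * cos ((real j + d) * x + \<theta>))"
      by (rule summable_comparison_test'[OF b, of 0]) (use cos_le[OF a2_le[OF t]] in auto)
    show "summable (\<lambda>j. a' t j * cos ((real j + d) * x + \<theta>))"
      by (rule summable_comparison_test'[OF summable_mult[OF b, of c], of 0]) (use cos_le[OF a'_le[OF t]] in auto)
    show "summable (\<lambda>j. \<bar>a t j * (real j + d)\<bar>)"
      by (rule summable_comparison_test'[OF b1, of 0]) (use a1_le[OF t] in auto)
    show "summable (\<lambda>j. \<bar>a t j * (real j + d)\<bar> * (real j + d))"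
      by (rule summable_comparison_test'[OF b, of 0])
         (use a2_le[OF t] d in \<open>auto simp: abs_mult power2_eq_square mult.assoc\<close>)
  qed
  show "((\<lambda>y. mode_series (a t) d \<theta> y) has_real_derivative
      mode_series (\<lambda>j. a t j * (real j + d)) d (\<theta> + pi/2) x) (at x)" if "t \<ge> 0" for x t
    by (rule mode_series_has_derivative[OF a_s(1,2)[OF that] d])
  show "((\<lambda>y. mode_series (\<lambda>j. a t j * (real j + d)) d (\<theta> + pi/2) y)
      has_real_derivative - mode_series (\<lambda>j. a t j * (real j + d)\<^sup>2) d \<theta> x) (at x)" if "t \<ge> 0" for x t
    using mode_series_has_derivative[OF a_s(5,6)[OF that] d, of "\<theta> + pi/2" x]
    unfolding mult.assoc power2_eq_square[symmetric]
    unfolding mode_series_plus_pi[OF a_s(3)[OF that]] .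
  show "((\<lambda>s. mode_series (a s) d \<theta> x) has_real_derivative mode_series (a' t) d \<theta> x) (at t)"
    if "t > 0" for x t
  proof -
    have "((\<lambda>s. mode_series (a s) d \<theta> x) has_real_derivative mode_series (a' t) d \<theta> x) (at t within {0<..})"
    proof (rule mode_series_has_derivative_coeffs)
      \<comment> \<open>A single majorant has to dominate both the coefficients and their
        derivatives, hence the sum of the two bounds.\<close>
      show "summable (\<lambda>j. \<bar>b j\<bar> + c * (\<bar>b j\<bar> * (real j + d)\<^sup>2))"
        by (rule summable_add[OF b0 summable_mult[OF b]])
      show "\<bar>a s j\<bar> \<le> \<bar>b j\<bar> + c * (\<bar>b j\<bar> * (real j + d)\<^sup>2)" if "s \<in> {0<..}" for s j
        using a_le[of s j] that c by (intro add_increasing2) auto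
      show "\<bar>a' s j\<bar> \<le> \<bar>b j\<bar> + c * (\<bar>b j\<bar> * (real j + d)\<^sup>2)" if "s \<in> {0<..}" for s j
        using a'_le[of s j] that by (intro add_increasing) auto
      show "((\<lambda>s. a s j) has_real_derivative a' s j) (at s within {0<..})" for s j
        unfolding a_def a'_def relax_coef_def by (auto intro!: derivative_eq_intros)
    qed (use that in auto)
    then show ?thesis using that by (simp add: at_within_open[of t "{0<..}"])
  qed
  show "mode_series (a' t) d \<theta> x + c * mode_series (\<lambda>j. a t j * (real j + d)\<^sup>2) d \<theta> x =
      mode_series (\<lambda>j. c * (real j + d)\<^sup>2 * b j) d \<theta> x" if "t \<ge> 0" for x t
    unfolding mode_series_def suminf_mult[OF a_s(3)[OF that], symmetric]
      suminf_add[OF a_s(4)[OF that] summable_mult[OF a_s(3)[OF that]]]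
    by (simp add: a_def a'_def relax_coef_def algebra_simps)
qed

section \<open>Coefficients of the solution\<close>

definition mode_coef :: "real \<Rightarrow> real \<Rightarrow> (real \<Rightarrow> real) \<Rightarrow> nat \<Rightarrow> real" where
  "mode_coef d \<theta> g3 j = 1 / pi * (LINT x:{-pi..pi}|lborel. g3 x * sin ((real j + d) * x + \<theta>))"

lemma coef2_Suc: "coef2 g3 (Suc j) = mode_coef 1 0 g3 j"
  using interval_integral_Icc[of "-pi" pi "\<lambda>x. g3 x * sin (real (Suc j) * x)"]
  by (simp add: coef2_def mode_coef_def add.commute)

text \<open>The phase \<open>-pi/2\<close> turns the sine of \<open>mode_coef\<close> into minus a
  cosine. This sign is the reason why the sine series enters \<open>u_sol\<close> with a
  minus.\<close>

lemma coef1_eq: "coef1 g3 j = - mode_coef (1/2) (-pi/2) g3 j"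
proof -
  have "sin ((real j + 1/2) * x + -pi/2) = - cos ((real j + 1/2) * x)" for x
    by (simp add: sin_diff)
  then show ?thesis
    using interval_integral_Icc[of "-pi" pi "\<lambda>x. g3 x * cos ((real j + 1/2) * x)"]
    by (simp only: coef1_def mode_coef_def) (simp add: set_integral_uminus set_lebesgue_integral_def)
qed

text \<open>By the three integrations by parts, \<open>mode_coef\<close> divided by
  \<open>(real j + d) ^ 3\<close> is a coefficient of the function itself. The remaining factor in
  the denominator makes the relaxed amplitude at time \<open>T\<close> equal to the coefficient of
  \<psi> - \<phi>.\<close>

definition sol_coef :: "real \<Rightarrow> real \<Rightarrow> real \<Rightarrow> real \<Rightarrow> (real \<Rightarrow> real) \<Rightarrow> (real \<Rightarrow> real) \<Rightarrow> nat \<Rightarrow> real" where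
  "sol_coef T c d \<theta> \<phi>3 \<psi>3 j = (mode_coef d \<theta> \<psi>3 j - mode_coef d \<theta> \<phi>3 j) /
     ((1 - exp (- c * (real j + d)\<^sup>2 * T)) * (real j + d) ^ 3)"

lemma relax_coef_sol_coef_end:
  assumes "c > 0" "d > 0" "T > 0"
  shows "relax_coef c d (sol_coef T c d \<theta> \<phi>3 \<psi>3) T j =
    (mode_coef d \<theta> \<psi>3 j - mode_coef d \<theta> \<phi>3 j) / (real j + d) ^ 3"
proof -
  have "exp (- c * (real j + d)\<^sup>2 * T) < 1" using assms by (simp add: add_nonneg_pos)
  then have "1 - exp (- c * (real j + d)\<^sup>2 * T) \<noteq> 0" by linarith
  then show ?thesis by (simp add: relax_coef_def sol_coef_def)
qed

text \<open>Of the three powers in the denominator two are used up by the weight; the remaining one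
  is exactly what makes the coefficients of square integrable functions summable. The exponential
  factor is bounded below by its value \<open>?q\<close> at the lowest frequency
  \<open>d\<close>.\<close>

lemma summable_sol_coef:
  assumes \<phi>: "C2_L2_third \<phi> \<phi>1 \<phi>2 \<phi>3" and \<psi>: "C2_L2_third \<psi> \<psi>1 \<psi>2 \<psi>3"
    and cdT: "c > 0" "d > 0" "T > 0" and m: "2 * d = real m"
  shows "summable (\<lambda>j. \<bar>sol_coef T c d \<theta> \<phi>3 \<psi>3 j\<bar> * (real j + d)\<^sup>2)"
proof -
  define N where "N g j = \<bar>LINT x:{-pi..pi}|lborel. g x * sin ((real j + d) * x + \<theta>)\<bar> / (real j + d)" for g and j :: nat
  have s: "summable (N g3)" if "C2_L2_third g g1 g2 g3" for g g1 g2 g3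
    unfolding N_def using that m cdT unfolding C2_L2_third_def by (intro summable_sin_coeffs) blast+
  let ?q = "1 - exp (- c * d\<^sup>2 * T)"
  have q: "?q > 0" using cdT by simp
  have S: "summable (\<lambda>j. (N \<psi>3 j + N \<phi>3 j) * (1 / (pi * ?q)))"
    by (intro summable_mult2 summable_add s[OF \<phi>] s[OF \<psi>])
  show ?thesis
  proof (rule summable_comparison_test'[OF S, of 0])
    fix j :: nat
    define L where "L = real j + d"
    have L: "L > 0" "d \<le> L" using cdT by (auto simp: L_def)
    have "d\<^sup>2 \<le> L\<^sup>2" using L cdT by (intro power_mono) auto
    then have "c * d\<^sup>2 * T \<le> c * L\<^sup>2 * T" using cdT by (intro mult_right_mono mult_left_mono) auto
    then have qL: "?q \<le> 1 - exp (- c * L\<^sup>2 * T)" by simp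
    define D where "D = \<bar>mode_coef d \<theta> \<psi>3 j - mode_coef d \<theta> \<phi>3 j\<bar>"
    have *: "D / L \<le> (N \<psi>3 j + N \<phi>3 j) / pi"
    proof -
      have "D \<le> \<bar>mode_coef d \<theta> \<psi>3 j\<bar> + \<bar>mode_coef d \<theta> \<phi>3 j\<bar>" unfolding D_def by (rule abs_triangle_ineq4)
      then have "D / L \<le> (\<bar>mode_coef d \<theta> \<psi>3 j\<bar> + \<bar>mode_coef d \<theta> \<phi>3 j\<bar>) / L"
        using L by (intro divide_right_mono) auto
      also have "\<dots> = (N \<psi>3 j + N \<phi>3 j) / pi"
        using L by (simp add: N_def mode_coef_def L_def[symmetric] abs_mult add_divide_distrib mult.commute)
      finally show ?thesis .
    qed
    have "D / L / (1 - exp (- c * L\<^sup>2 * T)) \<le> (N \<psi>3 j + N \<phi>3 j) / pi / ?q"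
      using q qL L by (intro frac_le[OF order_trans[OF _ *] *]) (simp_all add: D_def)
    then have "D / L / (1 - exp (- c * L\<^sup>2 * T)) \<le> (N \<psi>3 j + N \<phi>3 j) * (1 / (pi * ?q))"
      by simp
    moreover have "norm (\<bar>sol_coef T c d \<theta> \<phi>3 \<psi>3 j\<bar> * (real j + d)\<^sup>2) = D / L / (1 - exp (- c * L\<^sup>2 * T))"
      using q qL L
      by (simp add: sol_coef_def D_def L_def[symmetric] abs_mult abs_divide power2_eq_square power3_eq_cube)
    ultimately show "norm (\<bar>sol_coef T c d \<theta> \<phi>3 \<psi>3 j\<bar> * (real j + d)\<^sup>2) \<le> (N \<psi>3 j + N \<phi>3 j) * (1 / (pi * ?q))"
      by (simp only:)
  qed
qed

lemma integral_odd_eq_0: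
  fixes f :: "real \<Rightarrow> real"
  assumes "\<And>x. f (-x) = - f x"
  shows "integral {-a..a} f = 0"
  using Henstock_Kurzweil_Integration.integral_reflect_real[of a "-a" f] by (simp add: assms)

subsection \<open>Uniqueness\<close>

lemma regular_solution_diff:
  assumes "regular_solution T \<epsilon> \<phi> \<psi> u f" "regular_solution T \<epsilon> \<phi> \<psi> w h"
  shows "regular_solution T \<epsilon> (\<lambda>_. 0) (\<lambda>_. 0) (\<lambda>x t. u x t - w x t) (\<lambda>x. f x - h x)"
proof -
  obtain ux uxx ut where u:
      "continuous_on (Omega_cl T) (\<lambda>(x,t). u x t)"
      "\<forall>(x,t)\<in>Omega_cl T. ((\<lambda>y. u y t) has_real_derivative ux x t) (at x within {-pi..pi})"
      "continuous_on (Omega_cl T) (\<lambda>(x,t). ux x t)"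
      "\<forall>(x,t)\<in>Omega T. ((\<lambda>y. ux y t) has_real_derivative uxx x t) (at x)"
      "continuous_on (Omega T) (\<lambda>(x,t). uxx x t)"
      "\<forall>(x,t)\<in>Omega T. ((\<lambda>s. u x s) has_real_derivative ut x t) (at t)"
      "continuous_on (Omega T) (\<lambda>(x,t). ut x t)"
      "continuous_on {-pi..pi} f"
      "\<forall>(x,t)\<in>Omega T. ut x t - uxx x t + \<epsilon> * uxx (-x) t = f x"
      "\<forall>x\<in>{-pi..pi}. u x 0 = \<phi> x \<and> u x T = \<psi> x"
      "\<forall>t\<in>{0..T}. ux (-pi) t = 0 \<and> ux pi t = 0"
    using assms(1) unfolding regular_solution_def by blast
  obtain wx wxx wt where w:
      "continuous_on (Omega_cl T) (\<lambda>(x,t). w x t)"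
      "\<forall>(x,t)\<in>Omega_cl T. ((\<lambda>y. w y t) has_real_derivative wx x t) (at x within {-pi..pi})"
      "continuous_on (Omega_cl T) (\<lambda>(x,t). wx x t)"
      "\<forall>(x,t)\<in>Omega T. ((\<lambda>y. wx y t) has_real_derivative wxx x t) (at x)"
      "continuous_on (Omega T) (\<lambda>(x,t). wxx x t)"
      "\<forall>(x,t)\<in>Omega T. ((\<lambda>s. w x s) has_real_derivative wt x t) (at t)"
      "continuous_on (Omega T) (\<lambda>(x,t). wt x t)"
      "continuous_on {-pi..pi} h"
      "\<forall>(x,t)\<in>Omega T. wt x t - wxx x t + \<epsilon> * wxx (-x) t = h x"
      "\<forall>x\<in>{-pi..pi}. w x 0 = \<phi> x \<and> w x T = \<psi> x"
      "\<forall>t\<in>{0..T}. wx (-pi) t = 0 \<and> wx pi t = 0"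
    using assms(2) unfolding regular_solution_def by blast
  have cont: "continuous_on A (\<lambda>(x,t). p x t - q x t)"
    if "continuous_on A (\<lambda>(x,t). p x t)" "continuous_on A (\<lambda>(x,t). q x t)"
    for A :: "(real \<times> real) set" and p q :: "real \<Rightarrow> real \<Rightarrow> real"
    using continuous_on_diff[OF that] by (simp add: split_beta)
  show ?thesis
    unfolding regular_solution_def
  proof (intro exI conjI)
    show "\<forall>(x,t)\<in>Omega_cl T. ((\<lambda>y. u y t - w y t) has_real_derivative (\<lambda>x t. ux x t - wx x t) x t) (at x within {-pi..pi})"
      using u(2) w(2) by (auto intro!: DERIV_diff)
    show "\<forall>(x,t)\<in>Omega T. ((\<lambda>y. (\<lambda>x t. ux x t - wx x t) y t) has_real_derivative (\<lambda>x t. uxx x t - wxx x t) x t) (at x)"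
      using u(4) w(4) by (auto intro!: DERIV_diff)
    show "\<forall>(x,t)\<in>Omega T. ((\<lambda>s. u x s - w x s) has_real_derivative (\<lambda>x t. ut x t - wt x t) x t) (at t)"
      using u(6) w(6) by (auto intro!: DERIV_diff)
    show "\<forall>(x,t)\<in>Omega T. (\<lambda>x t. ut x t - wt x t) x t - (\<lambda>x t. uxx x t - wxx x t) x t
        + \<epsilon> * (\<lambda>x t. uxx x t - wxx x t) (-x) t = f x - h x"
      using u(9) w(9) by (fastforce simp: algebra_simps)
  qed (use u w in \<open>auto intro!: cont continuous_on_diff\<close>)
qed

text \<open>Recovers integrals over the full interval from those over \<open>[-a, a]\<close>, on
  which the uniqueness argument can differentiate.\<close>

lemma tendsto_symmetric_integral:
  fixes f :: "real \<Rightarrow> real"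
  assumes f: "continuous_on {-p..p} f" and p: "p > 0"
  shows "((\<lambda>a. integral {-a..a} f) \<longlongrightarrow> integral {-p..p} f) (at_left p)"
proof -
  have i: "f integrable_on {-p..p}" using f by (rule integrable_continuous_real)
  define F where "F x = integral {-p..x} f" for x
  have F: "continuous_on {-p..p} F"
    unfolding F_def by (rule indefinite_integral_continuous_1[OF i])
  have "continuous_on {0..p} (\<lambda>a. F a - F (-a))"
    by (intro continuous_intros continuous_on_compose2[OF F]) (use p in auto)
  then have "((\<lambda>a. F a - F (-a)) \<longlongrightarrow> F p - F (-p)) (at p within {0..p})"
    using p by (auto simp: continuous_on_def)
  then have *: "((\<lambda>a. F a - F (-a)) \<longlongrightarrow> F p - F (-p)) (at_left p)"
    using p by (simp add: at_within_Icc_at_left)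
  have F0: "F (-p) = 0" by (simp add: F_def)
  have eq: "F a - F (-a) = integral {-a..a} f" if "0 < a" "a < p" for a
  proof -
    have "f integrable_on {-p..a}" using that by (intro integrable_subinterval_real[OF i]) auto
    then show ?thesis
      using Henstock_Kurzweil_Integration.integral_combine[of "-p" "-a" a f] that unfolding F_def by auto
  qed
  have "eventually (\<lambda>a. F a - F (-a) = integral {-a..a} f) (at_left p)"
    using eventually_at_left_real[OF p] by (rule eventually_mono) (use eq in auto)
  from Lim_transform_eventually[OF * this] show ?thesis
    using F0 by (simp add: F_def)
qed

text \<open>Testing with \<open>e\<close> turns the reflected term into \<sigma> times the
  unreflected one, so the moment \<open>V\<close> of \<open>v\<close> satisfies
  \<open>V' + c V = G\<close> with \<open>c = (1 - \<sigma> * \<epsilon>) * L\<close> and the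
  constant moment \<open>G\<close> of \<open>g\<close>. As \<open>V\<close> vanishes at 0 and
  \<open>T\<close>, multiplying by \<open>exp (c * t)\<close> and integrating gives
  \<open>G = 0\<close>, and then \<open>V = 0\<close>.\<close>

lemma regular_solution_mode_eq_0:
  fixes e e' :: "real \<Rightarrow> real" and L \<sigma> :: real
  assumes T: "T > 0"
    and reg: "regular_solution T \<epsilon> (\<lambda>_. 0) (\<lambda>_. 0) v g"
    and e: "\<And>x. (e has_real_derivative e' x) (at x)"
    and e': "\<And>x. (e' has_real_derivative - L * e x) (at x)"
    and bc: "e' (-pi) = 0" "e' pi = 0"
    and sym: "\<And>x. e (-x) = \<sigma> * e x"
  shows "integral {-pi..pi} (\<lambda>x. g x * e x) = 0"
    and "\<And>t. t \<in> {0..T} \<Longrightarrow> integral {-pi..pi} (\<lambda>x. v x t * e x) = 0"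
proof -
  obtain vx vxx vt where
      vc: "continuous_on (Omega_cl T) (\<lambda>(x,t). v x t)" and
      vx: "\<forall>(x,t)\<in>Omega_cl T. ((\<lambda>y. v y t) has_real_derivative vx x t) (at x within {-pi..pi})" and
      vxc: "continuous_on (Omega_cl T) (\<lambda>(x,t). vx x t)" and
      vxx: "\<forall>(x,t)\<in>Omega T. ((\<lambda>y. vx y t) has_real_derivative vxx x t) (at x)" and
      vxxc: "continuous_on (Omega T) (\<lambda>(x,t). vxx x t)" and
      vt: "\<forall>(x,t)\<in>Omega T. ((\<lambda>s. v x s) has_real_derivative vt x t) (at t)" and
      vtc: "continuous_on (Omega T) (\<lambda>(x,t). vt x t)" and
      gc: "continuous_on {-pi..pi} g" and
      eq: "\<forall>(x,t)\<in>Omega T. vt x t - vxx x t + \<epsilon> * vxx (-x) t = g x" and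
      v0: "\<forall>x\<in>{-pi..pi}. v x 0 = 0 \<and> v x T = 0" and
      vbc: "\<forall>t\<in>{0..T}. vx (-pi) t = 0 \<and> vx pi t = 0"
    using reg unfolding regular_solution_def by blast
  have ec: "continuous_on A e" for A using e by (intro DERIV_continuous_on) (auto intro: has_field_derivative_at_within)
  have e'c: "continuous_on A e'" for A using e' by (intro DERIV_continuous_on) (auto intro: has_field_derivative_at_within)
  define c where "c = (1 - \<sigma> * \<epsilon>) * L"
  define V where "V a t = integral {-a..a} (\<lambda>x. v x t * e x)" for a t
  define G where "G a = integral {-a..a} (\<lambda>x. g x * e x)" for a
  define W where "W x t = vx x t * e x - v x t * e' x" for x t
  define B where "B a t = W a t - W (-a) t" for a t
  \<comment> \<open>An antiderivative of the integrating factor; \<open>c = 0\<close> occurs for the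
    constant mode.\<close>
  obtain H :: "real \<Rightarrow> real" where H: "\<And>t. (H has_real_derivative exp (c * t)) (at t)"
  proof (cases "c = 0")
    case True
    then show ?thesis by (intro that[of "\<lambda>t. t"]) auto
  next
    case False
    then show ?thesis by (intro that[of "\<lambda>t. exp (c * t) / c"]) (auto intro!: derivative_eq_intros)
  qed
  have slice: "continuous_on X (\<lambda>x. p x t)"
    if "continuous_on A (\<lambda>(x,t). p x t)" "\<And>x. x \<in> X \<Longrightarrow> (x, t) \<in> A"
    for A X t and p :: "real \<Rightarrow> real \<Rightarrow> real"
  proof -
    have "continuous_on X (\<lambda>x. (x, t))" by (intro continuous_intros)
    from continuous_on_compose2[OF that(1) this] show ?thesis using that(2) by auto
  qed
  text \<open>Since \<open>vxx\<close> and \<open>vt\<close> may blow up at the lateral boundary, the moments of \<open>v\<close> are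
    differentiated over \<open>[-a, a]\<close> with \<open>a < pi\<close>, and only the integrated ODE is passed to the limit.\<close>
  have V_deriv: "(V a has_real_derivative integral {-a..a} (\<lambda>x. vt x t * e x)) (at t)"
    if a: "0 < a" "a < pi" and t: "t \<in> {0<..<T}" for a t
  proof -
    have "((\<lambda>t. integral (cbox (-a) a) (\<lambda>x. v x t * e x)) has_field_derivative
        integral (cbox (-a) a) (\<lambda>x. vt x t * e x)) (at t within {0<..<T})"
    proof (rule leibniz_rule_field_derivative[where fx = "\<lambda>t x. vt x t * e x" and f = "\<lambda>t x. v x t * e x"])
      fix s x assume "s \<in> {0<..<T}" "x \<in> cbox (-a) a"
      then have "((\<lambda>s. v x s) has_real_derivative vt x s) (at s)"
        using vt a by (auto simp: Omega_def)
      then show "((\<lambda>s. v x s * e x) has_real_derivative vt x s * e x) (at s within {0<..<T})"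
        by (rule DERIV_cmult_right[OF has_field_derivative_at_within])
    next
      fix s assume "s \<in> {0<..<T}"
      then show "(\<lambda>x. v x s * e x) integrable_on cbox (-a) a"
        using a by (intro integrable_continuous continuous_intros ec slice[OF vc])
          (auto simp: Omega_cl_def)
    next
      have "continuous_on ({0<..<T} \<times> cbox (-a) a) (\<lambda>z. (\<lambda>(x,t). vt x t) (snd z, fst z))"
        by (rule continuous_on_compose2[OF vtc]) (use a in \<open>auto intro!: continuous_intros simp: Omega_def\<close>)
      moreover have "continuous_on ({0<..<T} \<times> cbox (-a) a) (\<lambda>z. e (snd z))"
        by (rule continuous_on_compose2[OF ec[of UNIV]]) (auto intro!: continuous_intros)
      ultimately show "continuous_on ({0<..<T} \<times> cbox (-a) a) (\<lambda>(t, x). vt x t * e x)"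
        by (auto simp: split_beta intro!: continuous_on_mult)
    qed (use t in auto)
    moreover have "(\<lambda>t. integral (cbox (-a) a) (\<lambda>x. v x t * e x)) = V a" by (simp add: V_def fun_eq_iff)
    ultimately show ?thesis
      using t by (simp add: at_within_open[of t "{0<..<T}"])
  qed
  have V_deriv_eq: "integral {-a..a} (\<lambda>x. vt x t * e x) = (1 - \<sigma> * \<epsilon>) * (B a t - L * V a t) + G a"
    if a: "0 < a" "a < pi" and t: "t \<in> {0<..<T}" for a t
  proof -
    define J where "J = integral {-a..a} (\<lambda>x. vxx x t * e x)"
    have vi: "continuous_on {-a..a} (\<lambda>x. v x t)" using a t
      by (intro slice[OF vc]) (auto simp: Omega_cl_def)
    have vxxi: "continuous_on {-a..a} (\<lambda>x. vxx x t)" using a t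
      by (intro slice[OF vxxc]) (auto simp: Omega_def)
    have vxxi': "continuous_on {-a..a} (\<lambda>x. vxx (-x) t)" using a
      by (intro continuous_on_compose2[OF vxxi]) (auto intro!: continuous_intros)
    have gi: "continuous_on {-a..a} g" using a by (intro continuous_on_subset[OF gc]) auto
    \<comment> \<open>Lagrange's identity: in the derivative of \<open>W\<close> the terms
      \<open>vx * e'\<close> cancel, and \<open>e'' = - L e\<close> leaves the integrand
      shown.\<close>
    have "((\<lambda>x. vxx x t * e x + L * (v x t * e x)) has_integral B a t) {-a..a}"
      unfolding B_def
    proof (rule fundamental_theorem_of_calculus)
      fix x assume x: "x \<in> {-a..a}"
      have 1: "((\<lambda>y. vx y t) has_real_derivative vxx x t) (at x)"
        using vxx x a t by (auto simp: Omega_def)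
      have "((\<lambda>y. v y t) has_real_derivative vx x t) (at x within {-pi..pi})"
        using vx x a t by (auto simp: Omega_cl_def)
      then have 2: "((\<lambda>y. v y t) has_real_derivative vx x t) (at x)"
        using x a by (simp add: at_within_Icc_at)
      have "((\<lambda>y. W y t) has_real_derivative vxx x t * e x + L * (v x t * e x)) (at x)"
        unfolding W_def
        by (rule derivative_eq_intros 1 2 e e' refl)+ (simp add: algebra_simps)
      then show "((\<lambda>y. W y t) has_vector_derivative vxx x t * e x + L * (v x t * e x)) (at x within {-a..a})"
        by (simp add: has_real_derivative_iff_has_vector_derivative has_vector_derivative_at_within)
    qed (use a in auto)
    then have "B a t = integral {-a..a} (\<lambda>x. vxx x t * e x + L * (v x t * e x))"
      by (simp add: integral_unique)
    also have "\<dots> = J + L * V a t"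
      unfolding J_def V_def
      by (subst Henstock_Kurzweil_Integration.integral_add)
         (auto intro!: integrable_continuous_real continuous_intros vi vxxi ec)
    finally have J: "J = B a t - L * V a t" by simp
    \<comment> \<open>Reflection moves the sign from the argument of \<open>vxx\<close> to that of
      \<open>e\<close>, where parity turns it into the factor \<sigma>.\<close>
    have refl: "integral {-a..a} (\<lambda>x. vxx (-x) t * e x) = \<sigma> * J"
    proof -
      have "integral {-a..a} (\<lambda>x. vxx (-x) t * e x) = integral {-a..a} (\<lambda>x. vxx x t * e (-x))"
        using Henstock_Kurzweil_Integration.integral_reflect_real[of a "-a" "\<lambda>x. vxx x t * e (-x)"] by simp
      also have "\<dots> = integral {-a..a} (\<lambda>x. \<sigma> * (vxx x t * e x))"
        by (simp add: sym mult_ac)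
      finally show ?thesis by (simp add: J_def)
    qed
    have "integral {-a..a} (\<lambda>x. vt x t * e x) =
        integral {-a..a} (\<lambda>x. vxx x t * e x - \<epsilon> * (vxx (-x) t * e x) + g x * e x)"
    proof (rule Henstock_Kurzweil_Integration.integral_cong)
      fix x assume "x \<in> {-a..a}"
      then have "vt x t - vxx x t + \<epsilon> * vxx (-x) t = g x" using eq a t by (auto simp: Omega_def)
      then have "vt x t = vxx x t - \<epsilon> * vxx (-x) t + g x" by simp
      then show "vt x t * e x = vxx x t * e x - \<epsilon> * (vxx (-x) t * e x) + g x * e x"
        by (simp only:) (simp add: algebra_simps)
    qed
    also have "\<dots> = J - \<epsilon> * (\<sigma> * J) + G a"
      unfolding J_def[symmetric] refl[symmetric] G_def
      by (subst Henstock_Kurzweil_Integration.integral_add,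
          (auto intro!: integrable_continuous_real continuous_intros vi vxxi vxxi' gi ec)[2],
          subst Henstock_Kurzweil_Integration.integral_diff)
         (auto intro!: integrable_continuous_real continuous_intros vi vxxi vxxi' gi ec simp: J_def)
    finally show ?thesis unfolding J by (simp add: algebra_simps)
  qed
  \<comment> \<open>The integrated form of the moment equation. For \<open>a < pi\<close> its
    derivative is a multiple of the boundary term \<open>B\<close>, which fades as \<open>a\<close>
    tends to \<open>pi\<close>; so \<open>K pi\<close> should be constant.\<close>
  define K where "K a t = exp (c * t) * V a t - G a * H t" for a t
  have K_deriv: "(K a has_real_derivative exp (c * t) * (1 - \<sigma> * \<epsilon>) * B a t) (at t)"
    if a: "0 < a" "a < pi" and t: "t \<in> {0<..<T}" for a t
  proof -
    have "(K a has_real_derivative exp (c * t) * c * V a t +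
        exp (c * t) * ((1 - \<sigma> * \<epsilon>) * (B a t - L * V a t) + G a) - G a * exp (c * t)) (at t)"
    proof -
      have "((\<lambda>t. exp (c * t)) has_real_derivative exp (c * t) * c) (at t)"
        by (auto intro!: derivative_eq_intros)
      from DERIV_diff[OF DERIV_mult[OF this V_deriv[OF a t]] DERIV_cmult[OF H, of "G a"]]
      show ?thesis unfolding V_deriv_eq[OF a t] K_def by (simp only: mult.commute)
    qed
    moreover have "E * (k * L) * w + E * (k * (y - L * w) + z) - z * E = E * k * y" for E k w y z :: real
      by (simp add: algebra_simps)
    ultimately show ?thesis by (simp only: c_def)
  qed
  have W_cont: "continuous_on (Omega_cl T) (\<lambda>(x,t). W x t)"
  proof -
    have "continuous_on (Omega_cl T) (\<lambda>z. e (fst z))" "continuous_on (Omega_cl T) (\<lambda>z. e' (fst z))"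
      by (rule continuous_on_compose2[OF ec[of UNIV]] continuous_on_compose2[OF e'c[of UNIV]];
          auto intro!: continuous_intros)+
    then show ?thesis
      using vc vxc by (auto simp: W_def split_beta intro!: continuous_intros)
  qed
  \<comment> \<open>\<open>W\<close> vanishes at both lateral sides, where \<open>vx\<close> and
    \<open>e'\<close> are 0. Uniform continuity on the compact rectangle makes the smallness uniform
    in \<open>t\<close>, as the mean value step requires.\<close>
  have B_small: "\<exists>b<pi. \<forall>a t. b < a \<longrightarrow> a < pi \<longrightarrow> t \<in> {0..T} \<longrightarrow> \<bar>B a t\<bar> \<le> \<eta>" if "\<eta> > 0" for \<eta>
  proof -
    have "compact (Omega_cl T)" unfolding Omega_cl_def by (intro compact_Times compact_Icc)
    then have "uniformly_continuous_on (Omega_cl T) (\<lambda>(x,t). W x t)"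
      by (rule compact_uniformly_continuous[OF W_cont])
    then obtain d where d: "d > 0" "\<And>z z'. z \<in> Omega_cl T \<Longrightarrow> z' \<in> Omega_cl T \<Longrightarrow> dist z' z < d
        \<Longrightarrow> dist ((\<lambda>(x,t). W x t) z') ((\<lambda>(x,t). W x t) z) < \<eta>/2"
      using \<open>\<eta> > 0\<close> unfolding uniformly_continuous_on_def by (metis half_gt_zero)
    show ?thesis
    proof (intro exI[of _ "max 0 (pi - d)"] conjI allI impI)
      fix a t assume a: "max 0 (pi - d) < a" "a < pi" and t: "t \<in> {0..T}"
      have 0: "W pi t = 0" "W (-pi) t = 0" using vbc t bc by (auto simp: W_def)
      have "\<bar>W a t\<bar> < \<eta>/2"
        using d(2)[of "(pi, t)" "(a, t)"] a t 0 by (auto simp: Omega_cl_def dist_Pair_Pair dist_real_def)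
      moreover have "\<bar>W (-a) t\<bar> < \<eta>/2"
        using d(2)[of "(-pi, t)" "(-a, t)"] a t 0 by (auto simp: Omega_cl_def dist_Pair_Pair dist_real_def)
      ultimately show "\<bar>B a t\<bar> \<le> \<eta>" unfolding B_def by linarith
    qed (use d in auto)
  qed
  have K_lim: "((\<lambda>a. K a t) \<longlongrightarrow> K pi t) (at_left pi)" if "t \<in> {0..T}" for t
    unfolding K_def V_def G_def using that
    by (intro tendsto_intros tendsto_symmetric_integral continuous_intros ec gc slice[OF vc])
       (auto simp: Omega_cl_def)
  \<comment> \<open>Bounds the factor in front of \<open>B\<close> for all times in [0, T], whatever
    the sign of \<open>c\<close>.\<close>
  define C where "C = exp (\<bar>c\<bar> * T) * \<bar>1 - \<sigma> * \<epsilon>\<bar>"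
  have K_bound: "\<bar>K pi t - K pi s\<bar> \<le> \<eta> * (C * T)"
    if st: "s \<in> {0<..<T}" "t \<in> {0<..<T}" "s < t" and \<eta>: "\<eta> > 0" for s t \<eta>
  proof -
    obtain b where b: "b < pi" "\<And>a t. b < a \<Longrightarrow> a < pi \<Longrightarrow> t \<in> {0..T} \<Longrightarrow> \<bar>B a t\<bar> \<le> \<eta>"
      using B_small[OF \<eta>] by blast
    have bound: "\<bar>K a t - K a s\<bar> \<le> \<eta> * (C * T)" if a: "max 0 b < a" "a < pi" for a
    proof -
      obtain z where z: "s < z" "z < t" "K a t - K a s = (t - s) * (exp (c * z) * (1 - \<sigma> * \<epsilon>) * B a z)"
        using MVT2[of s t "K a" "\<lambda>z. exp (c * z) * (1 - \<sigma> * \<epsilon>) * B a z"] K_deriv[of a] a st by auto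
      have "c * z \<le> \<bar>c\<bar> * T"
      proof -
        have "c * z \<le> \<bar>c\<bar> * z" using z st by (intro mult_right_mono) auto
        also have "\<dots> \<le> \<bar>c\<bar> * T" using z st by (intro mult_left_mono) auto
        finally show ?thesis .
      qed
      then have "exp (c * z) * \<bar>1 - \<sigma> * \<epsilon>\<bar> \<le> C"
        unfolding C_def by (intro mult_right_mono) auto
      moreover have "\<bar>B a z\<bar> \<le> \<eta>" using b(2)[of a z] a z st by auto
      moreover have "t - s \<le> T" using st by auto
      ultimately have "(t - s) * ((exp (c * z) * \<bar>1 - \<sigma> * \<epsilon>\<bar>) * \<bar>B a z\<bar>) \<le> T * (C * \<eta>)"
        using st T by (intro mult_mono) (auto simp: C_def)
      then show ?thesis using z st by (simp add: abs_mult mult_ac)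
    qed
    have "eventually (\<lambda>a. \<bar>K a t - K a s\<bar> \<le> \<eta> * (C * T)) (at_left pi)"
      using eventually_at_left_real[of "max 0 b" pi] b(1) bound by (auto elim!: eventually_mono)
    moreover have "((\<lambda>a. \<bar>K a t - K a s\<bar>) \<longlongrightarrow> \<bar>K pi t - K pi s\<bar>) (at_left pi)"
      using st by (intro tendsto_intros K_lim) auto
    ultimately show ?thesis
      by (intro tendsto_upperbound) auto
  qed
  have K_const: "K pi s = K pi t" if st: "s \<in> {0<..<T}" "t \<in> {0<..<T}" for s t
  proof -
    have *: "K pi s = K pi t" if "s \<in> {0<..<T}" "t \<in> {0<..<T}" "s < t" for s t
    proof -
      have "\<bar>K pi t - K pi s\<bar> \<le> 0"
      proof (rule field_le_epsilon)
        fix \<delta> :: real assume "\<delta> > 0"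
        have CT: "C * T \<ge> 0" using T by (auto simp: C_def)
        have "\<bar>K pi t - K pi s\<bar> \<le> \<delta> / (C * T + 1) * (C * T)"
          using K_bound[OF that, of "\<delta> / (C * T + 1)"] \<open>\<delta> > 0\<close> CT by simp
        also have "\<dots> \<le> \<delta>" using \<open>\<delta> > 0\<close> CT by (simp add: field_simps)
        finally show "\<bar>K pi t - K pi s\<bar> \<le> 0 + \<delta>" by simp
      qed
      then show ?thesis by simp
    qed
    show ?thesis using *[of s t] *[of t s] st by (cases s t rule: linorder_cases) auto
  qed
  have K_cont: "continuous_on {0..T} (K pi)"
  proof -
    have "continuous_on ({0..T} \<times> cbox (-pi) pi) (\<lambda>z. (\<lambda>(x,t). v x t) (snd z, fst z))"
      by (rule continuous_on_compose2[OF vc]) (auto intro!: continuous_intros simp: Omega_cl_def)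
    moreover have "continuous_on ({0..T} \<times> cbox (-pi) pi) (\<lambda>z. e (snd z))"
      by (rule continuous_on_compose2[OF ec[of UNIV]]) (auto intro!: continuous_intros)
    ultimately have "continuous_on ({0..T} \<times> cbox (-pi) pi) (\<lambda>(t, x). v x t * e x)"
      by (auto simp: split_beta intro!: continuous_on_mult)
    then have "continuous_on {0..T} (\<lambda>t. integral (cbox (-pi) pi) (\<lambda>x. v x t * e x))"
      by (rule integral_continuous_on_param)
    moreover have "continuous_on {0..T} H"
      using H by (intro DERIV_continuous_on) (auto intro: has_field_derivative_at_within)
    ultimately show ?thesis unfolding K_def V_def by (auto intro!: continuous_intros)
  qed
  \<comment> \<open>The equation gives constancy only for interior times, whereas the data live at 0
    and \<open>T\<close>; continuity of \<open>K pi\<close> bridges the gap, with \<open>T/2\<close>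
    as an arbitrary interior reference.\<close>
  have K_all: "K pi t = K pi (T/2)" if "t \<in> {0..T}" for t
  proof (rule continuous_constant_on_closure[of "{0<..<T}" "K pi"])
    show "continuous_on (closure {0<..<T}) (K pi)" using K_cont T by (simp add: closure_greaterThanLessThan)
    show "K pi s = K pi (T/2)" if "s \<in> {0<..<T}" for s using K_const[OF that, of "T/2"] T by simp
    show "t \<in> closure {0<..<T}" using that T by (simp add: closure_greaterThanLessThan)
  qed
  have V0: "V pi 0 = 0" "V pi T = 0"
    unfolding V_def using v0 by (auto intro!: integral_unique has_integral_eq[OF _ has_integral_0])
  \<comment> \<open>At both end times \<open>K pi\<close> reduces to \<open>- G pi * H\<close>, so
    equal values of \<open>K pi\<close> and different values of \<open>H\<close> force
    \<open>G pi = 0\<close>.\<close>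
  have "H 0 < H T"
    using T H by (intro DERIV_pos_imp_increasing[of 0 T H]) (auto intro!: exI[of _ "exp _"])
  moreover have "G pi * H 0 = G pi * H T"
  proof -
    have "K pi 0 = K pi T" using K_all[of 0] K_all[of T] T by simp
    then show ?thesis using V0 by (simp add: K_def)
  qed
  ultimately have G0: "G pi = 0" by auto
  then show "integral {-pi..pi} (\<lambda>x. g x * e x) = 0" by (simp add: G_def)
  fix t assume "t \<in> {0..T}"
  then have "K pi t = K pi 0" using K_all[of t] K_all[of 0] T by simp
  then show "integral {-pi..pi} (\<lambda>x. v x t * e x) = 0"
    using G0 V0 by (simp add: K_def V_def)
qed

lemma regular_solution_eq_0:
  assumes T: "T > 0" and reg: "regular_solution T \<epsilon> (\<lambda>_. 0) (\<lambda>_. 0) v g"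
  shows "\<And>x. x \<in> {-pi..pi} \<Longrightarrow> g x = 0"
    and "\<And>x t. (x, t) \<in> Omega_cl T \<Longrightarrow> v x t = 0"
proof -
  have gc: "continuous_on {-pi..pi} g" and vc: "continuous_on (Omega_cl T) (\<lambda>(x,t). v x t)"
    using reg unfolding regular_solution_def by blast+
  have cos: "integral {-pi..pi} (\<lambda>x. g x * cos (real k * x)) = 0"
    "\<And>t. t \<in> {0..T} \<Longrightarrow> integral {-pi..pi} (\<lambda>x. v x t * cos (real k * x)) = 0" for k :: nat
  proof -
    have 1: "((\<lambda>x. cos (real k * x)) has_real_derivative - real k * sin (real k * x)) (at x)" for x
      by (auto intro!: derivative_eq_intros)
    have 2: "((\<lambda>x. - real k * sin (real k * x)) has_real_derivative - (real k)\<^sup>2 * cos (real k * x)) (at x)" for x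
      by (auto intro!: derivative_eq_intros simp: power2_eq_square)
    note * = regular_solution_mode_eq_0[OF T reg 1 2, of 1]
    show "integral {-pi..pi} (\<lambda>x. g x * cos (real k * x)) = 0" by (rule *(1)) auto
    show "integral {-pi..pi} (\<lambda>x. v x t * cos (real k * x)) = 0" if "t \<in> {0..T}" for t
      by (rule *(2)[OF _ _ _ that]) auto
  qed
  have sin: "integral {-pi..pi} (\<lambda>x. g x * sin ((real k + 1/2) * x)) = 0"
    "\<And>t. t \<in> {0..T} \<Longrightarrow> integral {-pi..pi} (\<lambda>x. v x t * sin ((real k + 1/2) * x)) = 0" for k :: nat
  proof -
    \<comment> \<open>Here \<open>L\<close> is the frequency; the eigenvalue handed to the mode
      lemma is its square, with parity -1.\<close>
    define L where "L = real k + 1/2"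
    have 1: "((\<lambda>x. sin (L * x)) has_real_derivative L * cos (L * x)) (at x)" for x
      by (auto intro!: derivative_eq_intros)
    have 2: "((\<lambda>x. L * cos (L * x)) has_real_derivative - L\<^sup>2 * sin (L * x)) (at x)" for x
      by (auto intro!: derivative_eq_intros simp: power2_eq_square)
    note * = regular_solution_mode_eq_0[OF T reg 1 2, of "-1"]
    have 0: "cos (L * pi) = 0"
      by (simp add: L_def distrib_right cos_add)
    have "integral {-pi..pi} (\<lambda>x. g x * sin (L * x)) = 0" by (rule *(1)) (auto simp: 0)
    moreover have "integral {-pi..pi} (\<lambda>x. v x t * sin (L * x)) = 0" if "t \<in> {0..T}" for t
      by (rule *(2)[OF _ _ _ that]) (auto simp: 0)
    ultimately show "integral {-pi..pi} (\<lambda>x. g x * sin ((real k + 1/2) * x)) = 0"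
      "\<And>t. t \<in> {0..T} \<Longrightarrow> integral {-pi..pi} (\<lambda>x. v x t * sin ((real k + 1/2) * x)) = 0"
      unfolding L_def by auto
  qed
  show "g x = 0" if "x \<in> {-pi..pi}" for x
    by (rule orthogonal_cos_sin_half_eq_0[OF gc cos(1) sin(1) that])
  show "v x t = 0" if "(x, t) \<in> Omega_cl T" for x t
  proof -
    have t: "t \<in> {0..T}" and x: "x \<in> {-pi..pi}" using that by (auto simp: Omega_cl_def)
    have "continuous_on {-pi..pi} (\<lambda>x. (x, t))" by (intro continuous_intros)
    moreover have "(\<lambda>x. (x, t)) ` {-pi..pi} \<subseteq> Omega_cl T" using t by (auto simp: Omega_cl_def)
    ultimately have "continuous_on {-pi..pi} (\<lambda>x. v x t)"
      using continuous_on_compose2[OF vc, of "{-pi..pi}" "\<lambda>x. (x, t)"] by simp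
    from orthogonal_cos_sin_half_eq_0[OF this cos(2)[OF t] sin(2)[OF t] x] show ?thesis .
  qed
qed

subsection \<open>Existence\<close>

text \<open>These values serve twice: as Neumann conditions of the modes, whose derivatives are
  multiples of these sines, and as vanishing boundary terms in the integrations by parts.\<close>

lemma sin_mode_at_pi:
  "sin ((real j + 1) * pi + 0) = 0" "sin (- (real j + 1) * pi + 0) = 0"
  "sin ((real j + 1/2) * pi + -pi/2) = 0" "sin (- (real j + 1/2) * pi + -pi/2) = 0"
  by (simp_all add: distrib_right sin_add sin_diff cos_add left_diff_distrib)

text \<open>The final condition at time \<open>T\<close>. Absolute convergence makes the defect
  \<open>h\<close> continuous with moments computable term by term; the coefficients cancel every
  moment of \<psi> - \<phi>, so completeness gives \<open>h = 0\<close>.\<close>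

lemma mode_expansion:
  assumes \<phi>: "C2_L2_third \<phi> \<phi>1 \<phi>2 \<phi>3" and \<psi>: "C2_L2_third \<psi> \<psi>1 \<psi>2 \<psi>3"
    and bc: "\<phi>1 (-pi) = 0" "\<phi>1 pi = 0" "\<psi>1 (-pi) = 0" "\<psi>1 pi = 0"
    and a: "\<And>j. a j = (mode_coef 1 0 \<psi>3 j - mode_coef 1 0 \<phi>3 j) / (real j + 1) ^ 3" "summable (\<lambda>j. \<bar>a j\<bar>)"
    and b: "\<And>j. b j = (mode_coef (1/2) (-pi/2) \<psi>3 j - mode_coef (1/2) (-pi/2) \<phi>3 j) / (real j + 1/2) ^ 3"
      "summable (\<lambda>j. \<bar>b j\<bar>)"
    and x: "x \<in> {-pi..pi}"
  shows "\<phi> x + (mean0 \<psi> - mean0 \<phi>) + mode_series a 1 0 x + mode_series b (1/2) (-pi/2) x = \<psi> x"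
proof -
  define m where "m = mean0 \<psi> - mean0 \<phi>"
  define h where "h x = \<psi> x - \<phi> x - m - mode_series a 1 0 x - mode_series b (1/2) (-pi/2) x" for x
  have sc: "continuous_on {-pi..pi} (mode_series w d \<theta>)" if "summable (\<lambda>j. \<bar>w j\<bar>)" for w d \<theta>
    using continuous_on_mode_series[OF that, of "{-pi..pi}" "\<lambda>_. w" "\<lambda>x. x"]
    by (simp add: continuous_intros)
  note cont = C2_L2_third_continuous(1)[OF \<phi>] C2_L2_third_continuous(1)[OF \<psi>] sc[OF a(2)] sc[OF b(2)]
  have split: "integral {-pi..pi} (\<lambda>x. h x * w x) =
      integral {-pi..pi} (\<lambda>x. \<psi> x * w x) - integral {-pi..pi} (\<lambda>x. \<phi> x * w x)
      - m * integral {-pi..pi} w - integral {-pi..pi} (\<lambda>x. mode_series a 1 0 x * w x)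
      - integral {-pi..pi} (\<lambda>x. mode_series b (1/2) (-pi/2) x * w x)"
    if w: "continuous_on {-pi..pi} w" for w
  proof -
    note i = integrable_integral[OF integrable_continuous_real]
    have "((\<lambda>x. \<psi> x * w x - \<phi> x * w x - m * w x - mode_series a 1 0 x * w x
        - mode_series b (1/2) (-pi/2) x * w x) has_integral
      (integral {-pi..pi} (\<lambda>x. \<psi> x * w x) - integral {-pi..pi} (\<lambda>x. \<phi> x * w x)
      - m * integral {-pi..pi} w - integral {-pi..pi} (\<lambda>x. mode_series a 1 0 x * w x)
      - integral {-pi..pi} (\<lambda>x. mode_series b (1/2) (-pi/2) x * w x))) {-pi..pi}"
      by (intro has_integral_diff has_integral_mult_right i continuous_on_mult cont w)
    then show ?thesis by (simp add: h_def left_diff_distrib integral_unique)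
  qed
  have sin_half: "cos ((real j + 1/2) * x + -pi/2) = sin ((real j + 1/2) * x)" for j x
    by (simp add: cos_diff)
  have data: "integral {-pi..pi} (\<lambda>x. \<psi> x * cos ((real j + d) * x + \<theta>)) -
      integral {-pi..pi} (\<lambda>x. \<phi> x * cos ((real j + d) * x + \<theta>)) =
      pi * ((mode_coef d \<theta> \<psi>3 j - mode_coef d \<theta> \<phi>3 j) / (real j + d) ^ 3)"
    if "d > 0" "sin ((real j + d) * pi + \<theta>) = 0" "sin (- (real j + d) * pi + \<theta>) = 0" for d \<theta> j
  proof -
    have "real j + d \<noteq> 0" using that by linarith
    from integral_cos_eq_third_derivative[OF \<psi> bc(3,4) this that(2,3)]
      integral_cos_eq_third_derivative[OF \<phi> bc(1,2) this that(2,3)]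
    show ?thesis by (simp add: mode_coef_def diff_divide_distrib right_diff_distrib)
  qed
  have "h x = 0"
  proof (rule orthogonal_cos_sin_half_eq_0[OF _ _ _ x])
    show "continuous_on {-pi..pi} h" unfolding h_def by (intro continuous_intros cont)
  next
    fix k :: nat
    let ?w = "\<lambda>x. cos (real k * x)"
    have wc: "continuous_on {-pi..pi} ?w" by (intro continuous_intros)
    \<comment> \<open>The two families are orthogonal to each other by parity: an odd sine times an
      even cosine.\<close>
    have B: "integral {-pi..pi} (\<lambda>x. mode_series b (1/2) (-pi/2) x * ?w x) = 0"
    proof (rule integral_mode_series_eq_0[OF b(2) wc])
      show "integral {-pi..pi} (\<lambda>x. cos ((real j + 1/2) * x + -pi/2) * ?w x) = 0" for j
        unfolding sin_half by (rule integral_odd_eq_0) simp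
    qed
    show "integral {-pi..pi} (\<lambda>x. h x * ?w x) = 0"
    \<comment> \<open>The moment of index 0 is cancelled by the means, the one of index
      \<open>Suc j\<close> by the coefficient \<open>a j\<close>.\<close>
    proof (cases k)
      case 0
      have mean: "integral {-pi..pi} g = 2 * pi * mean0 g" if "continuous_on {-pi..pi} g" for g
        using interval_integral_Icc[of "-pi" pi g]
          set_borel_integral_eq_integral(2)[OF borel_integrable_atLeastAtMost'[OF that]]
        by (simp add: mean0_def)
      have A: "integral {-pi..pi} (\<lambda>x. mode_series a 1 0 x * ?w x) = 0"
      proof (rule integral_mode_series_eq_0[OF a(2) wc])
        show "integral {-pi..pi} (\<lambda>x. cos ((real j + 1) * x + 0) * ?w x) = 0" for j
          using integral_cos_int_mult[of "int (Suc j)" 0] 0 by (simp add: add.commute)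
      qed
      show ?thesis unfolding split[OF wc] A B
        using 0 mean[OF cont(1)] mean[OF cont(2)] by (simp add: m_def algebra_simps)
    next
      case [simp]: (Suc j)
      have w: "cos (real k * x) = cos ((real j + 1) * x + 0)" for x by (simp add: add.commute)
      have A: "integral {-pi..pi} (\<lambda>x. mode_series a 1 0 x * ?w x) = pi * a j"
        unfolding w by (rule integral_mode_series_cos[OF a(2), of _ 2]) auto
      have "integral {-pi..pi} ?w = 0"
        using integral_cos_int_mult[of "int (Suc j)" 0] by simp
      moreover have "integral {-pi..pi} (\<lambda>x. \<psi> x * ?w x) - integral {-pi..pi} (\<lambda>x. \<phi> x * ?w x) = pi * a j"
        unfolding w a(1) by (rule data) (simp_all only: sin_mode_at_pi zero_less_one)
      ultimately show ?thesis unfolding split[OF wc] A B by simp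
    qed
  next
    fix k :: nat
    let ?w = "\<lambda>x. sin ((real k + 1/2) * x)"
    have wc: "continuous_on {-pi..pi} ?w" by (intro continuous_intros)
    have A: "integral {-pi..pi} (\<lambda>x. mode_series a 1 0 x * ?w x) = 0"
    proof (rule integral_mode_series_eq_0[OF a(2) wc])
      show "integral {-pi..pi} (\<lambda>x. cos ((real j + 1) * x + 0) * ?w x) = 0" for j
        by (rule integral_odd_eq_0) simp
    qed
    have w: "sin ((real k + 1/2) * x) = cos ((real k + 1/2) * x + -pi/2)" for x unfolding sin_half ..
    have B: "integral {-pi..pi} (\<lambda>x. mode_series b (1/2) (-pi/2) x * ?w x) = pi * b k"
      unfolding w by (rule integral_mode_series_cos[OF b(2), of _ 1]) auto
    have "integral {-pi..pi} ?w = 0" by (rule integral_odd_eq_0) simp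
    moreover have "integral {-pi..pi} (\<lambda>x. \<psi> x * ?w x) - integral {-pi..pi} (\<lambda>x. \<phi> x * ?w x) = pi * b k"
      unfolding w b(1) by (rule data) (simp_all only: sin_mode_at_pi half_gt_zero zero_less_one)
    ultimately show "integral {-pi..pi} (\<lambda>x. h x * ?w x) = 0" unfolding split[OF wc] A B by simp
  qed
  then show ?thesis unfolding h_def m_def by simp
qed

lemma mode_series_even: "mode_series a d 0 (- x) = mode_series a d 0 x"
  by (simp add: mode_series_def)

lemma mode_series_odd:
  assumes "summable (\<lambda>j. \<bar>a j\<bar>)"
  shows "mode_series a d (-pi/2) (- x) = - mode_series a d (-pi/2) x"
proof -
  have eq: "cos (y + -pi/2) = sin y" for y :: real by (simp add: cos_diff)
  have "summable (\<lambda>j. a j * sin ((real j + d) * x))"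
    by (rule summable_comparison_test'[OF assms, of 0]) (simp add: abs_mult mult_left_le)
  from suminf_minus[OF this] show ?thesis
    unfolding mode_series_def eq by simp
qed

section \<open>Assembling the solution\<close>

theorem theorem2:
  fixes T \<epsilon> :: real
    and \<phi> \<phi>1 \<phi>2 \<phi>3 \<psi> \<psi>1 \<psi>2 \<psi>3 :: "real \<Rightarrow> real"
  assumes "T > 0" and "\<epsilon> \<noteq> 0" and "\<bar>\<epsilon>\<bar> < 1"
    and "C2_L2_third \<phi> \<phi>1 \<phi>2 \<phi>3" and "C2_L2_third \<psi> \<psi>1 \<psi>2 \<psi>3"
    and "\<phi>1 (-pi) = 0" and "\<phi>1 pi = 0" and "\<psi>1 (-pi) = 0" and "\<psi>1 pi = 0"
  shows "regular_solution T \<epsilon> \<phi> \<psi> (u_sol T \<epsilon> \<phi> \<psi> \<phi>3 \<psi>3) (f_sol T \<epsilon> \<phi> \<psi> \<phi>2 \<phi>3 \<psi>3)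
    \<and> (\<forall>u f. regular_solution T \<epsilon> \<phi> \<psi> u f \<longrightarrow>
          (\<forall>(x,t)\<in>Omega_cl T. u x t = u_sol T \<epsilon> \<phi> \<psi> \<phi>3 \<psi>3 x t) \<and>
          (\<forall>x\<in>{-pi..pi}. f x = f_sol T \<epsilon> \<phi> \<psi> \<phi>2 \<phi>3 \<psi>3 x))"
proof -
  note T = assms(1) and \<phi> = assms(4) and \<psi> = assms(5)
  have c: "1 - \<epsilon> > 0" "1 + \<epsilon> > 0" using assms(3) by auto
  define m where "m = mean0 \<psi> - mean0 \<phi>"
  define b1 where "b1 = sol_coef T (1 - \<epsilon>) 1 0 \<phi>3 \<psi>3"
  define b2 where "b2 = sol_coef T (1 + \<epsilon>) (1/2) (-pi/2) \<phi>3 \<psi>3"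
  have b1: "summable (\<lambda>j. \<bar>b1 j\<bar> * (real j + 1)\<^sup>2)"
    unfolding b1_def by (rule summable_sol_coef[OF \<phi> \<psi> c(1) _ T, of _ 2]) auto
  have b2: "summable (\<lambda>j. \<bar>b2 j\<bar> * (real j + 1/2)\<^sup>2)"
    unfolding b2_def by (rule summable_sol_coef[OF \<phi> \<psi> c(2) _ T, of _ 1]) auto
  \<comment> \<open>\<open>a1\<close> and \<open>a2\<close> are the amplitudes of the even and odd
    modes at time \<open>t\<close>; \<open>p1\<close> and \<open>p2\<close> below are their time
    derivatives.\<close>
  define a1 where "a1 = relax_coef (1 - \<epsilon>) 1 b1"
  define a2 where "a2 = relax_coef (1 + \<epsilon>) (1/2) b2"
  define p1 where "p1 t = (\<lambda>j. b1 j * ((1 - \<epsilon>) * (real j + 1)\<^sup>2 * exp (- (1 - \<epsilon>) * (real j + 1)\<^sup>2 * t)))" for t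
  define p2 where "p2 t = (\<lambda>j. b2 j * ((1 + \<epsilon>) * (real j + 1/2)\<^sup>2 * exp (- (1 + \<epsilon>) * (real j + 1/2)\<^sup>2 * t)))" for t
  have half: "(1/2 :: real) > 0" by simp
  note R1 = relax_series_continuous[OF b1 zero_less_one c(1), of 0, folded a1_def p1_def]
    relax_series_deriv_x[OF b1 zero_less_one c(1), of _ 0, folded a1_def p1_def]
    relax_series_deriv_xx[OF b1 zero_less_one c(1), of _ 0, folded a1_def p1_def]
    relax_series_deriv_t[OF b1 zero_less_one c(1), of _ 0, folded a1_def p1_def]
    relax_series_ode[OF b1 zero_less_one c(1), of _ 0, folded a1_def p1_def]
  note R2 = relax_series_continuous[OF b2 half c(2), of "-pi/2", folded a2_def p2_def]
    relax_series_deriv_x[OF b2 half c(2), of _ "-pi/2", folded a2_def p2_def]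
    relax_series_deriv_xx[OF b2 half c(2), of _ "-pi/2", folded a2_def p2_def]
    relax_series_deriv_t[OF b2 half c(2), of _ "-pi/2", folded a2_def p2_def]
    relax_series_ode[OF b2 half c(2), of _ "-pi/2", folded a2_def p2_def]
  have a1_s: "summable (\<lambda>j. \<bar>a1 t j\<bar>)" and a2_s: "summable (\<lambda>j. \<bar>a2 t j\<bar>)"
    and a2_s2: "summable (\<lambda>j. \<bar>a2 t j * (real j + 1/2)\<^sup>2\<bar>)" if "t \<ge> 0" for t
  proof -
    show "summable (\<lambda>j. \<bar>a1 t j\<bar>)"
      by (rule summable_comparison_test'[OF summable_mode_powers(1)[OF b1], of 0])
         (use abs_relax_coef_le[OF c(1) that] in \<open>auto simp: a1_def\<close>)
    show "summable (\<lambda>j. \<bar>a2 t j\<bar>)"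
      by (rule summable_comparison_test'[OF summable_mode_powers(1)[OF b2], of 0])
         (use abs_relax_coef_le[OF c(2) that] in \<open>auto simp: a2_def\<close>)
    show "summable (\<lambda>j. \<bar>a2 t j * (real j + 1/2)\<^sup>2\<bar>)"
      by (rule summable_comparison_test'[OF b2, of 0])
         (use abs_relax_coef_le[OF c(2) that] in \<open>auto simp: a2_def abs_mult intro!: mult_right_mono\<close>)
  qed
  have sin_half: "cos (y + -pi/2) = sin y" for y :: real by (simp add: cos_diff)
  \<comment> \<open>Limited to \<open>t \<ge> 0\<close>, where the amplitudes are bounded by the
    summable \<open>b1\<close> and \<open>b2\<close>; the sign of the sine series is extracted using
    that summability.\<close>
  have u_eq: "u_sol T \<epsilon> \<phi> \<psi> \<phi>3 \<psi>3 x t =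
      \<phi> x + t / T * m + mode_series (a1 t) 1 0 x + mode_series (a2 t) (1/2) (-pi/2) x"
    if t: "t \<ge> 0" for x t
  proof -
    have s: "summable (\<lambda>j. a2 t j * sin ((real j + 1/2) * x))"
      by (rule summable_comparison_test'[OF a2_s[OF t], of 0]) (simp add: abs_mult mult_left_le)
    have 1: "(\<Sum>j. let k = real (Suc j) in
          (1 - exp (-(1-\<epsilon>) * k\<^sup>2 * t)) * (coef2 \<psi>3 (Suc j) - coef2 \<phi>3 (Suc j))
          / ((1 - exp (-(1-\<epsilon>) * k\<^sup>2 * T)) * k ^ 3) * cos (k * x)) = mode_series (a1 t) 1 0 x"
      unfolding mode_series_def Let_def a1_def b1_def relax_coef_def sol_coef_def coef2_Suc
      by (intro suminf_cong) (simp add: add.commute)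
    have 2: "(\<Sum>j. let k = real j + 1/2 in
          (1 - exp (-(1+\<epsilon>) * k\<^sup>2 * t)) * (coef1 \<psi>3 j - coef1 \<phi>3 j)
          / ((1 - exp (-(1+\<epsilon>) * k\<^sup>2 * T)) * k ^ 3) * sin (k * x)) = - mode_series (a2 t) (1/2) (-pi/2) x"
    proof -
      have "(1 - exp (-(1+\<epsilon>) * k\<^sup>2 * t)) * (coef1 \<psi>3 j - coef1 \<phi>3 j)
          / ((1 - exp (-(1+\<epsilon>) * k\<^sup>2 * T)) * k ^ 3) * sin (k * x) = - (a2 t j * sin (k * x))"
        if "k = real j + 1/2" for j k
      proof -
        have "y * (-p - -q) / r * s = - ((p - q) / r * y * s)" for y p q r s :: real
          by (simp add: divide_inverse algebra_simps)
        then show ?thesis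
          unfolding a2_def b2_def relax_coef_def sol_coef_def coef1_eq that[symmetric] .
      qed
      then show ?thesis
        unfolding mode_series_def Let_def sin_half by (simp only: suminf_minus[OF s])
    qed
    show ?thesis unfolding u_sol_def 1 2 m_def by simp
  qed
  \<comment> \<open>Eigenvalue times \<open>b1\<close> or \<open>b2\<close>: the time-independent
    right-hand sides of the mode equations, which make up the series part of the source.\<close>
  define F1 where "F1 = mode_series (\<lambda>j. (1 - \<epsilon>) * (real j + 1)\<^sup>2 * b1 j) 1 0"
  define F2 where "F2 = mode_series (\<lambda>j. (1 + \<epsilon>) * (real j + 1/2)\<^sup>2 * b2 j) (1/2) (-pi/2)"
  have f_eq: "f_sol T \<epsilon> \<phi> \<psi> \<phi>2 \<phi>3 \<psi>3 x = - \<phi>2 x + \<epsilon> * \<phi>2 (-x) + m / T + F1 x + F2 x" for x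
  proof -
    have s: "summable (\<lambda>j. (1 - \<epsilon>) * (real j + 1)\<^sup>2 * b1 j * cos ((real j + 1) * x))"
    proof (rule summable_comparison_test'[OF summable_mult[OF b1, of "1 - \<epsilon>"], of 0])
      fix j :: nat
      have "\<bar>(1 - \<epsilon>) * (real j + 1)\<^sup>2 * b1 j\<bar> * \<bar>cos ((real j + 1) * x)\<bar> \<le> \<bar>(1 - \<epsilon>) * (real j + 1)\<^sup>2 * b1 j\<bar> * 1"
        by (intro mult_left_mono) auto
      then show "norm ((1 - \<epsilon>) * (real j + 1)\<^sup>2 * b1 j * cos ((real j + 1) * x)) \<le> (1 - \<epsilon>) * (\<bar>b1 j\<bar> * (real j + 1)\<^sup>2)"
        using c by (simp only: real_norm_def abs_mult) (simp add: mult_ac)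
    qed
    have 1: "(\<Sum>j. let k = real (Suc j) in
          (1-\<epsilon>) * (coef2 \<phi>3 (Suc j) - coef2 \<psi>3 (Suc j))
          / (k * (1 - exp (-(1-\<epsilon>) * k\<^sup>2 * T))) * cos (k * x)) = - F1 x"
    proof -
      have "(1-\<epsilon>) * (coef2 \<phi>3 (Suc j) - coef2 \<psi>3 (Suc j))
          / (k * (1 - exp (-(1-\<epsilon>) * k\<^sup>2 * T))) * cos (k * x) =
          - ((1 - \<epsilon>) * k\<^sup>2 * b1 j * cos (k * x))" if "k = real j + 1" for j k
      proof -
        have k: "k \<noteq> 0" using that by simp
        \<comment> \<open>The identity holds for every \<open>r\<close>: when \<open>r = 0\<close>
          both quotients are 0 by convention.\<close>
        have "A * (p - q) / (k * r) * s = - (A * k\<^sup>2 * ((q - p) / (r * k ^ 3)) * s)" for A p q r s :: real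
          using k by (cases "r = 0") (simp_all add: field_simps power2_eq_square power3_eq_cube)
        then show ?thesis
          unfolding b1_def sol_coef_def coef2_Suc that[symmetric] .
      qed
      then show ?thesis
        unfolding F1_def mode_series_def Let_def
        by (simp only: suminf_minus[OF s] add_0_right of_nat_Suc add.commute[of 1])
    qed
    have 2: "(\<Sum>j. let k = real j + 1/2 in
          (1+\<epsilon>) * (coef1 \<phi>3 j - coef1 \<psi>3 j)
          / (k * (1 - exp (-(1+\<epsilon>) * k\<^sup>2 * T))) * sin (k * x)) = F2 x"
    proof -
      have "(1+\<epsilon>) * (coef1 \<phi>3 j - coef1 \<psi>3 j)
          / (k * (1 - exp (-(1+\<epsilon>) * k\<^sup>2 * T))) * sin (k * x) =
          (1 + \<epsilon>) * k\<^sup>2 * b2 j * sin (k * x)" if "k = real j + 1/2" for j k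
      proof -
        have k: "k \<noteq> 0" using that by simp
        have "A * (- p - - q) / (k * r) * s = A * k\<^sup>2 * ((q - p) / (r * k ^ 3)) * s" for A p q r s :: real
          using k by (cases "r = 0") (simp_all add: field_simps power2_eq_square power3_eq_cube)
        then show ?thesis
          unfolding b2_def sol_coef_def coef1_eq that[symmetric] .
      qed
      then show ?thesis
        unfolding F2_def mode_series_def Let_def sin_half by (simp only:)
    qed
    show ?thesis unfolding f_sol_def 1 2 m_def by simp
  qed
  have d\<phi>: "(\<phi> has_real_derivative \<phi>1 x) (at x within {-pi..pi})"
    and d\<phi>1: "(\<phi>1 has_real_derivative \<phi>2 x) (at x within {-pi..pi})" if "x \<in> {-pi..pi}" for x
    using that \<phi> unfolding C2_L2_third_def by blast+
  have d\<phi>1': "(\<phi>1 has_real_derivative \<phi>2 x) (at x)" if "x \<in> {-pi<..<pi}" for x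
    using d\<phi>1[of x] that by (simp add: at_within_Icc_at)
  note \<phi>_cont = C2_L2_third_continuous[OF \<phi>]
  have sub: "Omega_cl T \<subseteq> {z. 0 \<le> snd z}" "Omega T \<subseteq> {z. 0 \<le> snd z}"
    by (auto simp: Omega_cl_def Omega_def)
  have fst_cont: "continuous_on A (\<lambda>(x,t). g x)"
    if "continuous_on {-pi..pi} g" "A \<subseteq> {-pi..pi} \<times> UNIV" for g :: "real \<Rightarrow> real" and A :: "(real \<times> real) set"
    unfolding split_beta
    by (rule continuous_on_compose2[OF that(1) continuous_on_fst[OF continuous_on_id]]) (use that(2) in auto)
  have sub': "Omega_cl T \<subseteq> {-pi..pi} \<times> UNIV" "Omega T \<subseteq> {-pi..pi} \<times> UNIV"
    by (auto simp: Omega_cl_def Omega_def)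
  define U where "U x t = \<phi> x + t / T * m + mode_series (a1 t) 1 0 x + mode_series (a2 t) (1/2) (-pi/2) x" for x t
  define Ux where "Ux x t = \<phi>1 x + mode_series (\<lambda>j. a1 t j * (real j + 1)) 1 (0 + pi/2) x +
    mode_series (\<lambda>j. a2 t j * (real j + 1/2)) (1/2) (-pi/2 + pi/2) x" for x t
  define Uxx where "Uxx x t = \<phi>2 x - mode_series (\<lambda>j. a1 t j * (real j + 1)\<^sup>2) 1 0 x -
    mode_series (\<lambda>j. a2 t j * (real j + 1/2)\<^sup>2) (1/2) (-pi/2) x" for x t
  define Ut where "Ut x t = m / T + mode_series (p1 t) 1 0 x + mode_series (p2 t) (1/2) (-pi/2) x" for x t
  have reg: "regular_solution T \<epsilon> \<phi> \<psi> (u_sol T \<epsilon> \<phi> \<psi> \<phi>3 \<psi>3) (f_sol T \<epsilon> \<phi> \<psi> \<phi>2 \<phi>3 \<psi>3)"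
    unfolding regular_solution_def
  proof (intro exI conjI)
    \<comment> \<open>Items 1 to 4 live on the closed rectangle, 5 to 8 on the open one, each time
      in the order value, first and second derivative in \<open>x\<close>, derivative in
      \<open>t\<close>.\<close>
    note C1 = R1(1-4)[THEN continuous_on_subset, OF sub(1)] R1(1-4)[THEN continuous_on_subset, OF sub(2)]
    note C2 = R2(1-4)[THEN continuous_on_subset, OF sub(1)] R2(1-4)[THEN continuous_on_subset, OF sub(2)]
    have "continuous_on (Omega_cl T) (\<lambda>(x,t). U x t)"
      using C1(1) C2(1) fst_cont[OF \<phi>_cont(1) sub'(1)] T
      unfolding U_def split_beta by (intro continuous_intros) auto
    then show "continuous_on (Omega_cl T) (\<lambda>(x,t). u_sol T \<epsilon> \<phi> \<psi> \<phi>3 \<psi>3 x t)"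
      by (rule continuous_on_cong[THEN iffD1, OF refl, rotated]) (auto simp: U_def u_eq Omega_cl_def)
    show "\<forall>(x,t)\<in>Omega_cl T. ((\<lambda>y. u_sol T \<epsilon> \<phi> \<psi> \<phi>3 \<psi>3 y t) has_real_derivative Ux x t) (at x within {-pi..pi})"
    proof safe
      fix x t assume "(x, t) \<in> Omega_cl T"
      then have x: "x \<in> {-pi..pi}" and t: "t \<ge> 0" by (auto simp: Omega_cl_def)
      show "((\<lambda>y. u_sol T \<epsilon> \<phi> \<psi> \<phi>3 \<psi>3 y t) has_real_derivative Ux x t) (at x within {-pi..pi})"
        unfolding u_eq[OF t] Ux_def
        by (rule derivative_eq_intros d\<phi>[OF x] has_field_derivative_at_within[OF R1(5)[OF t]]
            has_field_derivative_at_within[OF R2(5)[OF t]] refl)+ simp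
    qed
    show "continuous_on (Omega_cl T) (\<lambda>(x,t). Ux x t)"
      using C1(2) C2(2) fst_cont[OF \<phi>_cont(2) sub'(1)]
      unfolding Ux_def split_beta by (intro continuous_intros)
    show "\<forall>(x,t)\<in>Omega T. ((\<lambda>y. Ux y t) has_real_derivative Uxx x t) (at x)"
    proof safe
      fix x t assume "(x, t) \<in> Omega T"
      then have x: "x \<in> {-pi<..<pi}" and t: "t \<ge> 0" by (auto simp: Omega_def)
      show "((\<lambda>y. Ux y t) has_real_derivative Uxx x t) (at x)"
        unfolding Ux_def Uxx_def
        by (rule derivative_eq_intros d\<phi>1'[OF x] R1(6)[OF t] R2(6)[OF t] refl)+ simp
    qed
    show "continuous_on (Omega T) (\<lambda>(x,t). Uxx x t)"
      using C1(7) C2(7) fst_cont[OF \<phi>_cont(3) sub'(2)]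
      unfolding Uxx_def split_beta by (intro continuous_intros)
    show "\<forall>(x,t)\<in>Omega T. ((\<lambda>s. u_sol T \<epsilon> \<phi> \<psi> \<phi>3 \<psi>3 x s) has_real_derivative Ut x t) (at t)"
    proof safe
      fix x t assume "(x, t) \<in> Omega T"
      then have t: "t > 0" by (auto simp: Omega_def)
      have lin: "((\<lambda>s. \<phi> x + s / T * m) has_real_derivative m / T) (at t)"
        using T by (auto intro!: derivative_eq_intros simp: field_simps)
      have "((\<lambda>s. U x s) has_real_derivative Ut x t) (at t)"
        unfolding U_def Ut_def by (rule DERIV_add[OF DERIV_add[OF lin R1(7)[OF t]] R2(7)[OF t]])
      \<comment> \<open>\<open>U\<close> is known to agree with \<open>u_sol\<close> only for
        nonnegative times, so the derivative is transferred on the open set of positive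
        times.\<close>
      then show "((\<lambda>s. u_sol T \<epsilon> \<phi> \<psi> \<phi>3 \<psi>3 x s) has_real_derivative Ut x t) (at t)"
        by (rule has_field_derivative_transform_within_open[of _ _ _ "{0<..}"]) (use t in \<open>auto simp: U_def u_eq\<close>)
    qed
    show "continuous_on (Omega T) (\<lambda>(x,t). Ut x t)"
      using C1(8) C2(8) unfolding Ut_def split_beta by (intro continuous_intros)
    show "continuous_on {-pi..pi} (f_sol T \<epsilon> \<phi> \<psi> \<phi>2 \<phi>3 \<psi>3)"
    proof -
      have "continuous_on {-pi..pi} F1" unfolding F1_def
        by (rule continuous_on_mode_series[OF summable_mult[OF b1, of "1 - \<epsilon>"], of _ "\<lambda>_. _" "\<lambda>x. x"])
           (use c in \<open>auto simp: abs_mult mult_ac\<close>)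
      moreover have "continuous_on {-pi..pi} F2" unfolding F2_def
        by (rule continuous_on_mode_series[OF summable_mult[OF b2, of "1 + \<epsilon>"], of _ "\<lambda>_. _" "\<lambda>x. x"])
           (use c in \<open>auto simp: abs_mult mult_ac\<close>)
      moreover have "continuous_on {-pi..pi} (\<lambda>x. \<phi>2 (-x))"
        by (rule continuous_on_compose2[OF \<phi>_cont(3)]) (auto intro!: continuous_intros)
      ultimately show ?thesis unfolding f_eq[abs_def] by (intro continuous_intros \<phi>_cont)
    qed
    show "\<forall>(x,t)\<in>Omega T. Ut x t - Uxx x t + \<epsilon> * Uxx (-x) t = f_sol T \<epsilon> \<phi> \<psi> \<phi>2 \<phi>3 \<psi>3 x"
    proof safe
      fix x t assume "(x, t) \<in> Omega T"
      then have t: "t \<ge> 0" by (auto simp: Omega_def)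
      \<comment> \<open>The mode equation read backwards: the time-independent series is split at
        the current \<open>t\<close>. Parity of the modes then turns the reflected
        \<open>Uxx\<close> into the factors \<open>1 - \<epsilon>\<close> and
        \<open>1 + \<epsilon>\<close>.\<close>
      have F: "F1 x = mode_series (p1 t) 1 0 x + (1 - \<epsilon>) * mode_series (\<lambda>j. a1 t j * (real j + 1)\<^sup>2) 1 0 x"
        "F2 x = mode_series (p2 t) (1/2) (-pi/2) x + (1 + \<epsilon>) * mode_series (\<lambda>j. a2 t j * (real j + 1/2)\<^sup>2) (1/2) (-pi/2) x"
        unfolding F1_def F2_def using R1(8)[OF t, of x] R2(8)[OF t, of x] by simp_all
      show "Ut x t - Uxx x t + \<epsilon> * Uxx (-x) t = f_sol T \<epsilon> \<phi> \<psi> \<phi>2 \<phi>3 \<psi>3 x"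
        unfolding f_eq F Ut_def Uxx_def mode_series_even mode_series_odd[OF a2_s2[OF t]]
        by (simp add: algebra_simps)
    qed
    show "\<forall>x\<in>{-pi..pi}. u_sol T \<epsilon> \<phi> \<psi> \<phi>3 \<psi>3 x 0 = \<phi> x \<and> u_sol T \<epsilon> \<phi> \<psi> \<phi>3 \<psi>3 x T = \<psi> x"
    proof (intro ballI conjI)
      fix x assume x: "x \<in> {-pi..pi}"
      show "u_sol T \<epsilon> \<phi> \<psi> \<phi>3 \<psi>3 x 0 = \<phi> x"
        by (simp add: u_eq a1_def a2_def relax_coef_def mode_series_def)
      have "\<phi> x + (mean0 \<psi> - mean0 \<phi>) + mode_series (a1 T) 1 0 x + mode_series (a2 T) (1/2) (-pi/2) x = \<psi> x"
        using T by (intro mode_expansion[OF \<phi> \<psi> assms(6-9) _ a1_s _ a2_s x])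
          (simp_all only: a1_def a2_def b1_def b2_def relax_coef_sol_coef_end c half zero_less_one less_imp_le)
      then show "u_sol T \<epsilon> \<phi> \<psi> \<phi>3 \<psi>3 x T = \<psi> x"
        using T by (simp add: u_eq m_def)
    qed
    show "\<forall>t\<in>{0..T}. Ux (-pi) t = 0 \<and> Ux pi t = 0"
    proof -
      \<comment> \<open>Every term of the differentiated series is minus a sine that vanishes at
        both ends, so the Neumann conditions hold term by term.\<close>
      have shift: "cos (y + (\<theta> + pi/2)) = - sin (y + \<theta>)" for y \<theta> :: real
        by (simp add: cos_add sin_add)
      have 1: "cos ((real j + 1) * pi + (0 + pi/2)) = 0" "cos ((real j + 1) * (-pi) + (0 + pi/2)) = 0"
        "cos ((real j + 1/2) * pi + (-pi/2 + pi/2)) = 0" "cos ((real j + 1/2) * (-pi) + (-pi/2 + pi/2)) = 0" for j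
        unfolding shift mult_minus_right mult_minus_left[symmetric] sin_mode_at_pi by simp_all
      show ?thesis unfolding Ux_def mode_series_def 1 using assms(6,7) by simp
    qed
  qed
  moreover have "(\<forall>(x,t)\<in>Omega_cl T. u x t = u_sol T \<epsilon> \<phi> \<psi> \<phi>3 \<psi>3 x t) \<and>
          (\<forall>x\<in>{-pi..pi}. f x = f_sol T \<epsilon> \<phi> \<psi> \<phi>2 \<phi>3 \<psi>3 x)"
    if "regular_solution T \<epsilon> \<phi> \<psi> u f" for u f
    using regular_solution_eq_0[OF T regular_solution_diff[OF that reg]] by auto
  ultimately show ?thesis by blast
qed

end
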